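(* Let $f:\Delta\to\Gamma$ be a morphism of finite, connected, core graphs. Then $f$ is injective on fundamental groups if and only if there is an essential origami $\Omega$ on $\Delta$ that is compatible with $f$.
   Context: A graph (in the sense of Serre) $\Gamma$ has a vertex set $V_\Gamma$, an edge set $E_\Gamma$, maps $\iota,\tau:E_\Gamma\to V_\Gamma$ and a fixed-point-free involution $e\mapsto e^*$ of $E_\Gamma$ with $\tau(e)=\iota(e^* )$. Morphisms commute with all this structure. A morphism is an immersion if it is injective on $\iota^{-1}(v)$ for every vertex $v$. A finite graph is core if it has no vertices of valence $1$. Origamis. Let $\Delta$ be a finite graph. Let $\sim_O$ (the open relation) be an equivalence relation on $E_\Delta$, and define the closed relation by $e_1\sim_C e_2\Leftrightarrow e_1^*\sim_O e_2^*$; write $[e]_O,[e]_C$ for the classes. The edge graph $E_\Omega$ is the bipartite directed graph whose vertices are the $\sim_O$-classes (open vertices) and the $\sim_C$-classes (closed vertices), and whose edge set is $E_\Delta$, with $e$ going from $[e]_O$ to $[e]_C$. The vertex graph $V_\Omega$ is the bipartite directed graph whose vertices are the elements of $V_\Delta$ and the $\sim_C$-classes, and whose edge set is $E_\Delta$, with $e$ going from $\iota(e)\in V_\Delta$ to $[e]_C$. Connectivity, components, forests and trees refer to the underlying undirected graphs. The relation $\sim_O$ defines an origami $\Omega$ on $\Delta$ if: (a) (non-singularity) for each $e\in E_\Delta$, the edges $e$ and $e^*$ lie in different components of $E_\Omega$; (b) (global consistency) if $e_1\sim_O e_2$ then $\iota(e_1)$ and $\iota(e_2)$ are in the same component of $V_\Omega$;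 (c) (local consistency) if $e_1,e_2\in[e]_O$ then $\iota(e_1)$ and $\iota(e_2)$ are in the same component of $V_\Omega\smallsetminus e$ ($V_\Omega$ with the open edge $e$ removed). The origami $\Omega$ is essential if $V_\Omega$ and $E_\Omega$ are forests. Quotient graph. $\Delta/\Omega$ is the graph whose vertices are the components of $V_\Omega$ and whose edges are the components of $E_\Omega$; the involution is induced by $e\mapsto e^*$ (with $[e]_O\mapsto[e^*]_C$, $[e]_C\mapsto[e^*]_O$), and the initial vertex of the component containing $e$ is the component of $V_\Omega$ containing $\iota(e)$. The quotient map $q:\Delta\to\Delta/\Omega$ sends a vertex (edge) to its component in $V_\Omega$ (in $E_\Omega$). Compatibility. Let $f:\Delta\to\Gamma$ be a morphism of graphs. An origami $\Omega$ on $\Delta$ is compatible with $f$ if $f$ factors through the quotient map $q:\Delta\to\Delta/\Omega$ and the factor map $\Delta/\Omega\to\Gamma$ is an immersion. *)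

theory Defs
  imports "Graph_Theory.Graph_Theory" "HOL-Algebra.Group"
begin

text \<open>
  A graph in the sense of Serre is a locale instance \<open>bidirected_digraph G r\<close>:
  \<open>tail G\<close> is the initial vertex map, \<open>head G\<close> the terminal vertex map, and \<open>r\<close> the
  fixed-point-free involution \<open>e \<mapsto> e\<^sup>*\<close> on \<open>arcs G\<close>, which that locale normalises to be the
  identity off \<open>arcs G\<close>. Loops and multiple edges are allowed.
\<close>

definition serre_morphism ::
  "('a, 'b) pre_digraph \<Rightarrow> ('b \<Rightarrow> 'b) \<Rightarrow> ('c, 'd) pre_digraph \<Rightarrow> ('d \<Rightarrow> 'd) \<Rightarrow>
    ('a \<Rightarrow> 'c) \<Rightarrow> ('b \<Rightarrow> 'd) \<Rightarrow> bool" where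
  "serre_morphism G r H s fV fE \<longleftrightarrow>
     (\<forall>v\<in>verts G. fV v \<in> verts H) \<and>
     (\<forall>e\<in>arcs G. fE e \<in> arcs H \<and>
        tail H (fE e) = fV (tail G e) \<and>
        head H (fE e) = fV (head G e) \<and>
        fE (r e) = s (fE e))"

definition serre_immersion ::
  "('a, 'b) pre_digraph \<Rightarrow> ('b \<Rightarrow> 'b) \<Rightarrow> ('c, 'd) pre_digraph \<Rightarrow> ('d \<Rightarrow> 'd) \<Rightarrow>
    ('a \<Rightarrow> 'c) \<Rightarrow> ('b \<Rightarrow> 'd) \<Rightarrow> bool" where
  "serre_immersion G r H s fV fE \<longleftrightarrow>
     serre_morphism G r H s fV fE \<and> (\<forall>v\<in>verts G. inj_on fE (out_arcs G v))"

text \<open>Each geometric edge consists of two arcs, so the valence of a vertex is its out-degree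
  (a geometric loop counts twice).\<close>

definition core_graph :: "('a, 'b) pre_digraph \<Rightarrow> bool" where
  "core_graph G \<longleftrightarrow> (\<forall>v\<in>verts G. out_degree G v \<noteq> 1)"


section \<open>Fundamental groups\<close>

definition backtrack_cancel ::
  "('a, 'b) pre_digraph \<Rightarrow> ('b \<Rightarrow> 'b) \<Rightarrow> 'a \<Rightarrow> 'a \<Rightarrow> 'b list rel" where
  "backtrack_cancel G r u v =
     {(p @ [e, r e] @ q, p @ q) | p e q. pre_digraph.awalk G u (p @ [e, r e] @ q) v}"

definition path_homotopy ::
  "('a, 'b) pre_digraph \<Rightarrow> ('b \<Rightarrow> 'b) \<Rightarrow> 'a \<Rightarrow> 'a \<Rightarrow> 'b list rel" where
  "path_homotopy G r u v =
     {(p, q). pre_digraph.awalk G u p v \<and> pre_digraph.awalk G u q v \<and>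
        (p, q) \<in> (backtrack_cancel G r u v \<union> (backtrack_cancel G r u v)\<inverse>)\<^sup>*}"

definition fundamental_group ::
  "('a, 'b) pre_digraph \<Rightarrow> ('b \<Rightarrow> 'b) \<Rightarrow> 'a \<Rightarrow> 'b list set monoid" where
  "fundamental_group G r x =
     \<lparr>carrier = {p. pre_digraph.awalk G x p x} // path_homotopy G r x x,
      monoid.mult = (\<lambda>A B. \<Union>p\<in>A. \<Union>q\<in>B. path_homotopy G r x x `` {p @ q}),
      one = path_homotopy G r x x `` {[]}\<rparr>"

definition fundamental_group_map ::
  "('c, 'd) pre_digraph \<Rightarrow> ('d \<Rightarrow> 'd) \<Rightarrow> ('a \<Rightarrow> 'c) \<Rightarrow> ('b \<Rightarrow> 'd) \<Rightarrow> 'a \<Rightarrow>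
    'b list set \<Rightarrow> 'd list set" where
  "fundamental_group_map H s fV fE x A =
     (\<Union>p\<in>A. path_homotopy H s (fV x) (fV x) `` {map fE p})"

definition pi1_injective ::
  "('a, 'b) pre_digraph \<Rightarrow> ('b \<Rightarrow> 'b) \<Rightarrow> ('c, 'd) pre_digraph \<Rightarrow> ('d \<Rightarrow> 'd) \<Rightarrow>
    ('a \<Rightarrow> 'c) \<Rightarrow> ('b \<Rightarrow> 'd) \<Rightarrow> bool" where
  "pi1_injective G r H s fV fE \<longleftrightarrow>
     (\<forall>x\<in>verts G.
        inj_on (fundamental_group_map H s fV fE x) (carrier (fundamental_group G r x)))"


section \<open>Undirected components and forests\<close>

text \<open>A component is represented by its set of vertices.\<close>

definition component_of :: "('a, 'b) pre_digraph \<Rightarrow> 'a \<Rightarrow> 'a set" where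
  "component_of G u = pre_digraph.scc_of (with_proj (mk_symmetric G)) u"

definition components :: "('a, 'b) pre_digraph \<Rightarrow> 'a set set" where
  "components G = pre_digraph.sccs_verts (with_proj (mk_symmetric G))"

text \<open>
  The library's \<open>forest\<close> only excludes directed cycles. For the underlying undirected multigraph,
  every arc may be traversed in both directions, and a cycle uses each arc at most once
  (in particular, two parallel arcs form a cycle of length 2).
\<close>

definition two_way :: "('a, 'b) pre_digraph \<Rightarrow> ('a, 'b \<times> bool) pre_digraph" where
  "two_way G =
     \<lparr>verts = verts G, arcs = arcs G \<times> UNIV,
      tail = (\<lambda>(e, fwd). if fwd then tail G e else head G e),
      head = (\<lambda>(e, fwd). if fwd then head G e else tail G e)\<rparr>"

definition undirected_forest :: "('a, 'b) pre_digraph \<Rightarrow> bool" where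
  "undirected_forest G \<longleftrightarrow>
     \<not> (\<exists>p. pre_digraph.cycle (two_way G) p \<and> distinct (map fst p))"


section \<open>Origamis\<close>

text \<open>Throughout, \<open>R\<close> is the open relation.\<close>

definition closed_rel :: "('a, 'b) pre_digraph \<Rightarrow> ('b \<Rightarrow> 'b) \<Rightarrow> 'b rel \<Rightarrow> 'b rel" where
  "closed_rel D r R = {(e1, e2). e1 \<in> arcs D \<and> e2 \<in> arcs D \<and> (r e1, r e2) \<in> R}"

datatype 'b edge_vertex = Open_Class "'b set" | Closed_Class "'b set"

datatype ('a, 'b) vertex_vertex = Vertex 'a | VClosed_Class "'b set"

definition edge_graph ::
  "('a, 'b) pre_digraph \<Rightarrow> ('b \<Rightarrow> 'b) \<Rightarrow> 'b rel \<Rightarrow> ('b edge_vertex, 'b) pre_digraph" where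
  "edge_graph D r R =
     \<lparr>verts = Open_Class ` (arcs D // R) \<union> Closed_Class ` (arcs D // closed_rel D r R),
      arcs = arcs D,
      tail = (\<lambda>e. Open_Class (R `` {e})),
      head = (\<lambda>e. Closed_Class (closed_rel D r R `` {e}))\<rparr>"

definition vertex_graph ::
  "('a, 'b) pre_digraph \<Rightarrow> ('b \<Rightarrow> 'b) \<Rightarrow> 'b rel \<Rightarrow> (('a, 'b) vertex_vertex, 'b) pre_digraph" where
  "vertex_graph D r R =
     \<lparr>verts = Vertex ` verts D \<union> VClosed_Class ` (arcs D // closed_rel D r R),
      arcs = arcs D,
      tail = (\<lambda>e. Vertex (tail D e)),
      head = (\<lambda>e. VClosed_Class (closed_rel D r R `` {e}))\<rparr>"

definition quotient_vertex_map ::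
  "('a, 'b) pre_digraph \<Rightarrow> ('b \<Rightarrow> 'b) \<Rightarrow> 'b rel \<Rightarrow> 'a \<Rightarrow> ('a, 'b) vertex_vertex set" where
  "quotient_vertex_map D r R v = component_of (vertex_graph D r R) (Vertex v)"

text \<open>The component of the edge \<open>e\<close> is the component of its open endpoint (equivalently, of its
  closed endpoint).\<close>

definition quotient_edge_map ::
  "('a, 'b) pre_digraph \<Rightarrow> ('b \<Rightarrow> 'b) \<Rightarrow> 'b rel \<Rightarrow> 'b \<Rightarrow> 'b edge_vertex set" where
  "quotient_edge_map D r R e = component_of (edge_graph D r R) (Open_Class (R `` {e}))"

definition origami :: "('a, 'b) pre_digraph \<Rightarrow> ('b \<Rightarrow> 'b) \<Rightarrow> 'b rel \<Rightarrow> bool" where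
  "origami D r R \<longleftrightarrow>
     equiv (arcs D) R \<and>
     (\<forall>e\<in>arcs D. quotient_edge_map D r R e \<noteq> quotient_edge_map D r R (r e)) \<and>
     (\<forall>(e1, e2)\<in>R.
        component_of (vertex_graph D r R) (Vertex (tail D e1)) =
        component_of (vertex_graph D r R) (Vertex (tail D e2))) \<and>
     (\<forall>e\<in>arcs D. \<forall>e1\<in>R `` {e}. \<forall>e2\<in>R `` {e}.
        component_of (pre_digraph.del_arc (vertex_graph D r R) e) (Vertex (tail D e1)) =
        component_of (pre_digraph.del_arc (vertex_graph D r R) e) (Vertex (tail D e2)))"

definition essential_origami :: "('a, 'b) pre_digraph \<Rightarrow> ('b \<Rightarrow> 'b) \<Rightarrow> 'b rel \<Rightarrow> bool" where
  "essential_origami D r R \<longleftrightarrow>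
     origami D r R \<and>
     undirected_forest (vertex_graph D r R) \<and> undirected_forest (edge_graph D r R)"


section \<open>The quotient graph\<close>

text \<open>The induced involution uses that \<open>r\<close> maps the open class of \<open>e\<close> onto the closed class of
  \<open>r e\<close>, and vice versa.\<close>

fun swap_class :: "('b \<Rightarrow> 'b) \<Rightarrow> 'b edge_vertex \<Rightarrow> 'b edge_vertex" where
  "swap_class r (Open_Class A) = Closed_Class (r ` A)"
| "swap_class r (Closed_Class A) = Open_Class (r ` A)"

definition quotient_rev ::
  "('a, 'b) pre_digraph \<Rightarrow> ('b \<Rightarrow> 'b) \<Rightarrow> 'b rel \<Rightarrow> 'b edge_vertex set \<Rightarrow> 'b edge_vertex set" where
  "quotient_rev D r R C =
     (if C \<in> components (edge_graph D r R) then swap_class r ` C else C)"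

definition quotient_tail ::
  "('a, 'b) pre_digraph \<Rightarrow> ('b \<Rightarrow> 'b) \<Rightarrow> 'b rel \<Rightarrow> 'b edge_vertex set \<Rightarrow>
    ('a, 'b) vertex_vertex set" where
  "quotient_tail D r R C =
     (THE X. \<exists>e\<in>arcs D. quotient_edge_map D r R e = C \<and> X = quotient_vertex_map D r R (tail D e))"

definition quotient_graph ::
  "('a, 'b) pre_digraph \<Rightarrow> ('b \<Rightarrow> 'b) \<Rightarrow> 'b rel \<Rightarrow>
    (('a, 'b) vertex_vertex set, 'b edge_vertex set) pre_digraph" where
  "quotient_graph D r R =
     \<lparr>verts = components (vertex_graph D r R),
      arcs = components (edge_graph D r R),
      tail = quotient_tail D r R,
      head = (\<lambda>C. quotient_tail D r R (quotient_rev D r R C))\<rparr>"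

definition origami_compatible ::
  "('a, 'b) pre_digraph \<Rightarrow> ('b \<Rightarrow> 'b) \<Rightarrow> ('c, 'd) pre_digraph \<Rightarrow> ('d \<Rightarrow> 'd) \<Rightarrow>
    ('a \<Rightarrow> 'c) \<Rightarrow> ('b \<Rightarrow> 'd) \<Rightarrow> 'b rel \<Rightarrow> bool" where
  "origami_compatible D r H s fV fE R \<longleftrightarrow>
     (\<exists>gV gE.
        serre_immersion (quotient_graph D r R) (quotient_rev D r R) H s gV gE \<and>
        (\<forall>v\<in>verts D. fV v = gV (quotient_vertex_map D r R v)) \<and>
        (\<forall>e\<in>arcs D. fE e = gE (quotient_edge_map D r R e)))"

end

theory Submission
  imports Defs
begin

text \<open>
  From origamis to injectivity: local consistency says that, in the forest \<open>V\<^sub>\<Omega>\<close>, the hull of the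
  initial vertices of an open class avoids the edges of that class. Hence each component of
  \<open>E\<^sub>\<Omega>\<close>, with its open vertices blown up to these hulls, immerses into the forest \<open>V\<^sub>\<Omega>\<close>. As a
  consequence, a nonempty reduced walk of \<open>\<Delta>\<close> whose image is null-homotopic determines a nonempty
  path without backtracking in \<open>V\<^sub>\<Omega>\<close> with the same ends, so that it cannot be closed.

  From injectivity to origamis: take a maximal open relation for which both graphs are forests,
  the open classes are consistent even after deleting all edges of \<open>V\<^sub>\<Omega>\<close> with the same image in
  \<open>\<Gamma>\<close>, and any two linked vertices are joined by a walk that is null-homotopic in the quotient. If
  the quotient did not immerse into \<open>\<Gamma>\<close>, two open classes could be merged: if that created a cycle
  in \<open>V\<^sub>\<Omega>\<close>, there would be a nontrivial element in the kernel.
\<close>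

section \<open>Free reduction of words\<close>

text \<open>Both directions turn on the gap between two relations on edges: the open relation, on
  which the forest arguments rest, and lying in one component of the edge graph, which is what an
  immersion of the quotient yields. A path in the vertex graph that avoids one letter (one edge of
  \<Gamma>) closes the gap both times. Towards injectivity, choosing a null excursion as short as
  possible supplies such a path, and it forces open equivalence. Towards origamis, such a path is
  what keeps a merged relation consistent; maximality therefore speaks directly only about edges
  linked in this way. The forest property of the edge graph is not imposed on the maximal relation:
  it is derived from that of the vertex graph, in which letter consistency allows a path of the edge
  graph to be followed. Acyclicity is used in the form that every arc is a bridge, and injectivity
  in the form that a closed walk with freely trivial image is freely trivial.\<close>

definition cancel :: "('b \<Rightarrow> 'b) \<Rightarrow> 'b \<Rightarrow> 'b list \<Rightarrow> 'b list" where
  "cancel r a w = (case w of [] \<Rightarrow> [a] | b # w' \<Rightarrow> if b = r a then w' else a # w)"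

text \<open>Each letter acts on reduced words by \<open>cancel\<close>, that is, by left
  multiplication in normal form. A word acts by the composite, applied here to the empty word, so
  that equality of normal forms is preserved by common prefixes.\<close>

definition free_red :: "('b \<Rightarrow> 'b) \<Rightarrow> 'b list \<Rightarrow> 'b list" where
  "free_red r w = foldr (cancel r) w []"

abbreviation reduced :: "('b \<Rightarrow> 'b) \<Rightarrow> 'b list \<Rightarrow> bool" where
  "reduced r \<equiv> successively (\<lambda>a b. b \<noteq> r a)"

lemma free_red_Nil [simp]: "free_red r [] = []"
  and free_red_Cons: "free_red r (a # w) = cancel r a (free_red r w)"
  by (simp_all add: free_red_def)

lemma reduced_cancel: "reduced r w \<Longrightarrow> reduced r (cancel r a w)"
  by (cases w) (auto simp: cancel_def successively_Cons)

lemma reduced_free_red: "reduced r (free_red r w)"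
  by (induction w) (auto simp: free_red_Cons intro: reduced_cancel)

text \<open>A letter and its inverse act on reduced words by mutually inverse maps. Reducedness
  matters when \<open>w\<close> starts with \<open>a\<close>: the remainder then does not start with
  \<open>r a\<close>, so \<open>a\<close> is put back instead of cancelling further.\<close>

lemma cancel_cancel:
  assumes "r (r a) = a" "reduced r w"
  shows "cancel r a (cancel r (r a) w) = w"
  using assms by (cases w) (auto simp: cancel_def successively_Cons split: list.splits)

lemma free_red_append_right:
  "free_red r w = free_red r w' \<Longrightarrow> free_red r (x @ w) = free_red r (x @ w')"
  by (simp add: free_red_def)

lemma free_red_append:
  assumes "\<And>a. r (r a) = a"
  shows "free_red r (free_red r x @ w) = free_red r (x @ w)"
proof (induction x)
  case (Cons a x)
  show ?case
  proof (cases "\<exists>x'. free_red r x = r a # x'")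
    case True
    then obtain x' where x': "free_red r x = r a # x'" by blast
    then have "free_red r (x @ w) = cancel r (r a) (free_red r (x' @ w))"
      using Cons.IH by (simp add: free_red_Cons)
    then have "cancel r a (free_red r (x @ w)) = free_red r (x' @ w)"
      using cancel_cancel[of r a, OF assms reduced_free_red] by simp
    then show ?thesis using x' by (simp add: free_red_Cons cancel_def)
  next
    case False
    then have "free_red r (a # x) = a # free_red r x"
      by (auto simp: free_red_Cons cancel_def split: list.splits)
    then show ?thesis using Cons.IH by (simp add: free_red_Cons)
  qed
qed simp

lemma free_red_append_cong:
  assumes "\<And>a. r (r a) = a" "free_red r x = free_red r x'" "free_red r w = free_red r w'"
  shows "free_red r (x @ w) = free_red r (x' @ w')"
  by (metis assms free_red_append free_red_append_right)

lemma free_red_cancel_pair: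
  assumes "\<And>a. r (r a) = a"
  shows "free_red r (x @ a # r a # w) = free_red r (x @ w)"
  by (rule free_red_append_right)
    (simp add: free_red_Cons cancel_cancel assms reduced_free_red)

lemma free_red_cancel_inner:
  assumes "\<And>a. r (r a) = a" "free_red r t = []"
  shows "free_red r (x @ a # t @ r a # w) = free_red r (x @ w)"
proof -
  have "free_red r (t @ r a # w) = free_red r (r a # w)"
    using free_red_append_cong[of r t "[]" "r a # w" "r a # w"] assms by simp
  then have "free_red r (x @ a # t @ r a # w) = free_red r (x @ a # r a # w)"
    by (intro free_red_append_right) (simp add: free_red_Cons)
  then show ?thesis using free_red_cancel_pair[OF assms(1)] by metis
qed

lemma free_red_cancel_inverse:
  assumes "\<And>a. r (r a) = a"
  shows "free_red r (x @ map r (rev x)) = []"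
proof (induction x rule: rev_induct)
  case (snoc a x)
  then show ?case
    using free_red_cancel_pair[OF assms, of x a "map r (rev x)"] by simp
qed simp

lemma free_red_cancel_inverse':
  assumes "\<And>a. r (r a) = a"
  shows "free_red r (map r (rev x) @ x) = []"
  using free_red_cancel_inverse[OF assms, of "map r (rev x)"]
  by (simp add: rev_map comp_def assms)

lemma free_red_eq_iff:
  assumes "\<And>a. r (r a) = a"
  shows "free_red r (x @ map r (rev y)) = [] \<longleftrightarrow> free_red r x = free_red r y"
proof
  assume null: "free_red r (x @ map r (rev y)) = []"
  have "free_red r x = free_red r (x @ map r (rev y) @ y)"
    using free_red_append_right[of r "map r (rev y) @ y" "[]" x]
      free_red_cancel_inverse'[OF assms] by simp
  also have "\<dots> = free_red r y"
    using free_red_append_cong[OF assms, of "x @ map r (rev y)" "[]" y y] null by simp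
  finally show "free_red r x = free_red r y" .
next
  assume "free_red r x = free_red r y"
  then have "free_red r (x @ map r (rev y)) = free_red r (y @ map r (rev y))"
    by (intro free_red_append_cong assms) simp_all
  then show "free_red r (x @ map r (rev y)) = []"
    using free_red_cancel_inverse[OF assms] by simp
qed

text \<open>The image of a reduced word need not be reduced, so the two sides agree only after
  reducing again.\<close>

lemma free_red_map:
  assumes inv: "\<And>a. s (s a) = a" and g: "\<And>a. a \<in> set w \<Longrightarrow> g (r a) = s (g a)"
  shows "free_red s (map g (free_red r w)) = free_red s (map g w)"
  using g
proof (induction w)
  case (Cons a w)
  then have IH: "free_red s (map g (free_red r w)) = free_red s (map g w)" by simp
  show ?case
  proof (cases "\<exists>w'. free_red r w = r a # w'")
    case True
    then obtain w' where w': "free_red r w = r a # w'" by blast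
    then have "free_red s (map g w) = cancel s (s (g a)) (free_red s (map g w'))"
      using IH Cons.prems by (simp add: free_red_Cons)
    then show ?thesis
      using w' cancel_cancel[of s "g a", OF inv reduced_free_red]
      by (simp add: free_red_Cons) (simp add: cancel_def)
  next
    case False
    then have "free_red r (a # w) = a # free_red r w"
      by (auto simp: free_red_Cons cancel_def split: list.splits)
    then show ?thesis using IH by (simp add: free_red_Cons)
  qed
qed simp

text \<open>The first letter of the normal form is an occurrence in \<open>w\<close> that survives;
  everything before it has cancelled.\<close>

lemma free_red_Cons_split:
  assumes "\<And>a. r (r a) = a" "free_red r w = b # w'"
  shows "\<exists>t u. w = t @ b # u \<and> free_red r t = [] \<and> free_red r u = w'"
  using assms(2)
proof (induction "length w" arbitrary: w b w' rule: less_induct)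
  case less
  then obtain a v where w: "w = a # v" by (cases w) auto
  show ?case
  proof (cases "\<exists>v'. free_red r v = r a # v'")
    case False
    then have "free_red r w = a # free_red r v"
      using w by (auto simp: free_red_Cons cancel_def split: list.splits)
    then show ?thesis using less.prems w by (intro exI[of _ "[]"] exI[of _ v]) simp
  next
    case True
    then obtain v' where v': "free_red r v = r a # v'" by blast
    then have "v' = b # w'" using less.prems w by (simp add: free_red_Cons cancel_def)
    obtain t1 u1 where 1: "v = t1 @ r a # u1" "free_red r t1 = []" "free_red r u1 = v'"
      using less.hyps[of v "r a" v'] v' w by auto
    \<comment> \<open>The suffix \<open>u1\<close> starts after the partner of \<open>a\<close> and
      is in general shorter than the tail of \<open>w\<close>; hence the induction on
      length.\<close>
    obtain t2 u2 where 2: "u1 = t2 @ b # u2" "free_red r t2 = []" "free_red r u2 = w'"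
      using less.hyps[of u1 b w'] 1 w \<open>v' = b # w'\<close> by auto
    have "free_red r (a # t1 @ r a # t2) = []"
      using free_red_cancel_inner[OF assms(1), where x = "[]"] 1 2 by simp
    then show ?thesis
      using 1 2 w by (intro exI[of _ "a # t1 @ r a # t2"] exI[of _ u2]) simp
  qed
qed

text \<open>The first letter of a null word must cancel against a later \<open>r a\<close>. Among
  all possible partners the earliest is taken; its minimality is the last conclusion and later
  yields a path that avoids a letter.\<close>

lemma null_word_split:
  assumes inv: "\<And>a. r (r a) = a" and null: "free_red r (a # w) = []"
  obtains t u where "w = t @ r a # u" "free_red r t = []" "free_red r u = []"
    "\<And>t1 t2. t = t1 @ r a # t2 \<Longrightarrow> free_red r t1 \<noteq> []"
proof -
  define P where "P = (\<lambda>t. \<exists>u. w = t @ r a # u \<and> free_red r t = [])"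
  have "free_red r w = [r a]"
    using null by (auto simp: free_red_Cons cancel_def split: list.splits if_splits)
  then have "\<exists>t. P t" unfolding P_def using free_red_Cons_split[OF inv] by metis
  then obtain t where t: "P t" "\<And>t'. P t' \<Longrightarrow> length t \<le> length t'"
    using ex_has_least_nat[of P _ length] by metis
  then obtain u where u: "w = t @ r a # u" "free_red r t = []" unfolding P_def by blast
  have "free_red r u = []"
    using null u free_red_cancel_inner[OF inv u(2), where x = "[]" and w = u] by simp
  moreover have "free_red r t1 \<noteq> []" if "t = t1 @ r a # t2" for t1 t2
  proof
    assume "free_red r t1 = []"
    then have "P t1" unfolding P_def using u that by simp
    then show False using t(2)[of t1] that by simp
  qed
  ultimately show ?thesis using that u by blast
qed


section \<open>Homotopy of walks and injectivity on fundamental groups\<close>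

lemma (in bidirected_digraph) arev_in_arcs_iff: "arev a \<in> arcs G \<longleftrightarrow> a \<in> arcs G"
  using arev_arev arev_dom by metis

lemma (in bidirected_digraph) awalk_rev:
  assumes "awalk u p v"
  shows "awalk v (map arev (rev p)) u"
  using assms
proof (induction p arbitrary: u)
  case Nil
  then show ?case by (auto simp: awalk_Nil_iff)
next
  case (Cons e p)
  then have e: "e \<in> arcs G" "tail G e = u" "awalk (head G e) p v"
    by (auto simp: awalk_Cons_iff)
  then have "awalk (head G e) [arev e] u"
    by (auto simp: awalk_Cons_iff awalk_Nil_iff arev_in_arcs_iff head_arev)
  then show ?case using Cons.IH[OF e(3)] by (auto simp: awalk_appendI)
qed

lemma (in bidirected_digraph) backtrack_cancel_awalk:
  assumes "(p, q) \<in> backtrack_cancel G arev u v"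
  shows "awalk u p v" "awalk u q v" "free_red arev p = free_red arev q"
proof -
  obtain x e y where pq: "p = x @ [e, arev e] @ y" "q = x @ y"
    and w: "awalk u (x @ [e, arev e] @ y) v"
    using assms unfolding backtrack_cancel_def by blast
  show "awalk u p v" using w pq by simp
  obtain z where z: "awalk u x z" "awalk z (e # arev e # y) v"
    using w by (auto simp: awalk_append_iff)
  then have "awalk z y v" by (auto simp: awalk_Cons_iff arev_in_arcs_iff head_arev)
  then show "awalk u q v" using z pq by (auto simp: awalk_appendI)
  show "free_red arev p = free_red arev q"
    using pq free_red_cancel_pair[OF arev_arev, of x e y] by simp
qed

lemma (in bidirected_digraph) backtrack_cancel_rtrancl_awalk:
  assumes "(p, q) \<in> (backtrack_cancel G arev u v)\<^sup>*" "awalk u p v"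
  shows "awalk u q v"
  using assms by (induction rule: rtrancl_induct) (auto dest: backtrack_cancel_awalk)

text \<open>Deletions alone lead from a walk to its normal form. Hence homotopic walks meet in a
  common reduced walk, and homotopy becomes equality of \<open>free_red\<close>.\<close>

lemma (in bidirected_digraph) backtrack_cancel_free_red:
  assumes "awalk u p v"
  shows "(p, free_red arev p) \<in> (backtrack_cancel G arev u v)\<^sup>*"
  using assms
proof (induction p arbitrary: u)
  case (Cons e p)
  then have e: "e \<in> arcs G" "tail G e = u" "awalk (head G e) p v"
    by (auto simp: awalk_Cons_iff)
  have shift: "(e # x, e # y) \<in> backtrack_cancel G arev u v"
    if xy: "(x, y) \<in> backtrack_cancel G arev (head G e) v" for x y
  proof -
    obtain a d b where "x = a @ [d, arev d] @ b" "y = a @ b"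
      and w: "awalk (head G e) (a @ [d, arev d] @ b) v"
      using xy unfolding backtrack_cancel_def by blast
    moreover have "awalk u ((e # a) @ [d, arev d] @ b) v"
      using w e awalk_Cons_iff[of u e "a @ [d, arev d] @ b"] by (simp only: append_Cons)
    ultimately show ?thesis
      unfolding backtrack_cancel_def by (intro CollectI exI[of _ "e # a"] exI) simp
  qed
  have "(p, free_red arev p) \<in> (backtrack_cancel G arev (head G e) v)\<^sup>*"
    by (rule Cons.IH[OF e(3)])
  then have 1: "(e # p, e # free_red arev p) \<in> (backtrack_cancel G arev u v)\<^sup>*"
    by (induction rule: rtrancl_induct) (auto intro: rtrancl_into_rtrancl shift)
  show ?case
  proof (cases "\<exists>w. free_red arev p = arev e # w")
    case True
    then obtain w where w: "free_red arev p = arev e # w" by blast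
    have "awalk u (e # arev e # w) v"
      using backtrack_cancel_rtrancl_awalk[OF 1 Cons.prems] w by simp
    then have "(e # free_red arev p, w) \<in> backtrack_cancel G arev u v"
      using w unfolding backtrack_cancel_def
      by (intro CollectI exI[of _ "[]"] exI[of _ e] exI[of _ w]) simp
    then show ?thesis using 1 w by (simp add: free_red_Cons cancel_def)
  next
    case False
    then have "free_red arev (e # p) = e # free_red arev p"
      by (auto simp: free_red_Cons cancel_def split: list.splits)
    then show ?thesis using 1 by simp
  qed
qed simp

lemma (in bidirected_digraph) awalk_free_red:
  assumes "awalk u p v"
  shows "awalk u (free_red arev p) v"
  using backtrack_cancel_rtrancl_awalk[OF backtrack_cancel_free_red[OF assms] assms] .

lemma (in bidirected_digraph) path_homotopy_iff:
  "(p, q) \<in> path_homotopy G arev u v \<longleftrightarrow>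
     awalk u p v \<and> awalk u q v \<and> free_red arev p = free_red arev q"
proof
  let ?B = "backtrack_cancel G arev u v"
  {
    assume "(p, q) \<in> path_homotopy G arev u v"
    then have w: "awalk u p v" "awalk u q v" and pq: "(p, q) \<in> (?B \<union> ?B\<inverse>)\<^sup>*"
      unfolding path_homotopy_def by auto
    from pq have "free_red arev p = free_red arev q"
      by (induction rule: rtrancl_induct) (auto dest: backtrack_cancel_awalk(3))
    with w show "awalk u p v \<and> awalk u q v \<and> free_red arev p = free_red arev q" by simp
  }
  assume w: "awalk u p v \<and> awalk u q v \<and> free_red arev p = free_red arev q"
  have "(p, free_red arev p) \<in> (?B \<union> ?B\<inverse>)\<^sup>*"
    using backtrack_cancel_free_red w rtrancl_mono[of ?B "?B \<union> ?B\<inverse>"] by blast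
  moreover have "(free_red arev q, q) \<in> (?B\<inverse>)\<^sup>*"
    using backtrack_cancel_free_red w by (simp add: rtrancl_converse)
  then have "(free_red arev p, q) \<in> (?B \<union> ?B\<inverse>)\<^sup>*"
    using w rtrancl_mono[of "?B\<inverse>" "?B \<union> ?B\<inverse>"] by auto
  ultimately show "(p, q) \<in> path_homotopy G arev u v"
    using w unfolding path_homotopy_def by auto
qed

lemma serre_morphism_awalk:
  assumes "bidirected_digraph G r" "bidirected_digraph H s"
    and f: "serre_morphism G r H s fV fE"
    and "pre_digraph.awalk G u p v"
  shows "pre_digraph.awalk H (fV u) (map fE p) (fV v)"
  using assms(4)
proof (induction p arbitrary: u)
  interpret G: bidirected_digraph G r by fact
  interpret H: bidirected_digraph H s by fact
  {
    case Nil
    then show ?case using f by (auto simp: G.awalk_Nil_iff H.awalk_Nil_iff serre_morphism_def)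
  next
    case (Cons e p)
    then show ?case using f by (auto simp: G.awalk_Cons_iff H.awalk_Cons_iff serre_morphism_def)
  }
qed

text \<open>The usual reduction to the kernel, done on representatives: \<open>cls\<close> and
  \<open>img\<close> describe a homotopy class and its image as explicit sets of walks, and two
  loops are compared through the product of one with the reverse of the other.\<close>

lemma pi1_injective_iff:
  assumes G: "bidirected_digraph G r" and H: "bidirected_digraph H s"
    and f: "serre_morphism G r H s fV fE"
  shows "pi1_injective G r H s fV fE \<longleftrightarrow>
    (\<forall>x p. pre_digraph.awalk G x p x \<and> free_red s (map fE p) = [] \<longrightarrow> free_red r p = [])"
proof -
  interpret G: bidirected_digraph G r by fact
  interpret H: bidirected_digraph H s by fact
  have cls: "path_homotopy G r x x `` {p} = {q. G.awalk x q x \<and> free_red r q = free_red r p}"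
    if "G.awalk x p x" for x p
    using that by (auto simp: G.path_homotopy_iff)
  have img: "fundamental_group_map H s fV fE x (path_homotopy G r x x `` {p}) =
      {q. H.awalk (fV x) q (fV x) \<and> free_red s q = free_red s (map fE p)}"
    if p: "G.awalk x p x" for x p
  proof -
    have "free_red s (map fE q) = free_red s (map fE p)"
      if q: "G.awalk x q x" "free_red r q = free_red r p" for q
    proof -
      have "free_red s (map fE (free_red r a)) = free_red s (map fE a)" if "G.awalk x a x" for a
      proof (intro free_red_map H.arev_arev)
        fix e assume "e \<in> set a"
        then have "e \<in> arcs G" using that by (auto simp: G.awalk_def)
        then show "fE (r e) = s (fE e)" using f by (auto simp: serre_morphism_def)
      qed
      then show ?thesis using p q by metis
    qed
    note * = this
    have "(z \<in> fundamental_group_map H s fV fE x (path_homotopy G r x x `` {p})) \<longleftrightarrow>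
        (\<exists>q. G.awalk x q x \<and> free_red r q = free_red r p \<and>
          (map fE q, z) \<in> path_homotopy H s (fV x) (fV x))" for z
      unfolding fundamental_group_map_def cls[OF p] by blast
    moreover have "(\<exists>q. G.awalk x q x \<and> free_red r q = free_red r p \<and>
          (map fE q, z) \<in> path_homotopy H s (fV x) (fV x)) \<longleftrightarrow>
        H.awalk (fV x) z (fV x) \<and> free_red s z = free_red s (map fE p)" for z
    proof (intro iffI; (elim exE conjE)?)
      fix q assume q: "G.awalk x q x" "free_red r q = free_red r p"
        and z: "(map fE q, z) \<in> path_homotopy H s (fV x) (fV x)"
      show "H.awalk (fV x) z (fV x) \<and> free_red s z = free_red s (map fE p)"
        using z *[OF q] by (simp add: H.path_homotopy_iff)
    next
      assume "H.awalk (fV x) z (fV x)" "free_red s z = free_red s (map fE p)"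
      then have "(map fE p, z) \<in> path_homotopy H s (fV x) (fV x)"
        using serre_morphism_awalk[OF G H f p] by (simp add: H.path_homotopy_iff)
      then show "\<exists>q. G.awalk x q x \<and> free_red r q = free_red r p \<and>
          (map fE q, z) \<in> path_homotopy H s (fV x) (fV x)"
        using p by (intro exI[of _ p] conjI) simp_all
    qed
    ultimately show ?thesis unfolding set_eq_iff mem_Collect_eq by (simp only: simp_thms)
  qed
  have carrier: "carrier (fundamental_group G r x) =
      {path_homotopy G r x x `` {p} | p. G.awalk x p x}" for x
    by (auto simp: fundamental_group_def quotient_def)
  have fm: "free_red s (map fE p @ map s (rev (map fE q))) =
      free_red s (map fE (p @ map r (rev q)))" if "G.awalk x q x" for x p q
  proof -
    have "\<forall>a\<in>set q. s (fE a) = fE (r a)" using that f by (auto simp: serre_morphism_def G.awalk_def)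
    then show ?thesis by (auto simp: rev_map comp_def intro!: arg_cong[of _ _ "free_red s"])
  qed
  show ?thesis
  proof
    assume inj: "pi1_injective G r H s fV fE"
    show "\<forall>x p. G.awalk x p x \<and> free_red s (map fE p) = [] \<longrightarrow> free_red r p = []"
    proof (intro allI impI, elim conjE)
      fix x p assume p: "G.awalk x p x" "free_red s (map fE p) = []"
      then have x: "x \<in> verts G" by (simp add: G.awalk_def)
      then have nil: "G.awalk x [] x" by (simp add: G.awalk_Nil_iff)
      have "path_homotopy G r x x `` {p} = path_homotopy G r x x `` {[]}"
      proof (rule inj_onD[of "fundamental_group_map H s fV fE x"])
        show "inj_on (fundamental_group_map H s fV fE x) (carrier (fundamental_group G r x))"
          using inj x by (simp add: pi1_injective_def)
      qed (use p nil in \<open>auto simp only: img carrier list.map free_red_Nil\<close>)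
      moreover have "p \<in> path_homotopy G r x x `` {p}"
        using p by (simp add: G.path_homotopy_iff)
      ultimately have "p \<in> path_homotopy G r x x `` {[]}" by (simp only:)
      then show "free_red r p = []" using cls[OF nil] by simp
    qed
  next
    assume triv: "\<forall>x p. G.awalk x p x \<and> free_red s (map fE p) = [] \<longrightarrow> free_red r p = []"
    show "pi1_injective G r H s fV fE"
      unfolding pi1_injective_def
    proof (intro ballI inj_onI)
      fix x A B assume x: "x \<in> verts G"
        and AB: "A \<in> carrier (fundamental_group G r x)" "B \<in> carrier (fundamental_group G r x)"
        and eq: "fundamental_group_map H s fV fE x A = fundamental_group_map H s fV fE x B"
      obtain p q where p: "G.awalk x p x" "A = path_homotopy G r x x `` {p}"
        and q: "G.awalk x q x" "B = path_homotopy G r x x `` {q}"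
        using AB carrier by auto
      have "free_red s (map fE p) = free_red s (map fE q)"
        using eq serre_morphism_awalk[OF G H f p(1)] unfolding p(2) q(2) img[OF p(1)] img[OF q(1)]
        by (simp add: set_eq_iff) metis
      then have "free_red s (map fE (p @ map r (rev q))) = []"
        using free_red_eq_iff[OF H.arev_arev] fm[OF q(1)] by metis
      then have "free_red r (p @ map r (rev q)) = []"
        using triv G.awalk_appendI[OF p(1) G.awalk_rev[OF q(1)]] by simp
      then have "free_red r p = free_red r q"
        using free_red_eq_iff[OF G.arev_arev] by metis
      then show "A = B" using p q cls by simp
    qed
  qed
qed


section \<open>Undirected connectivity\<close>

text \<open>The set \<open>A\<close> lists the arcs that may be used, in either direction. Whole
  components, deletion of a single arc and deletion of all arcs with one letter are the instances
  \<open>UNIV\<close>, \<open>- {e}\<close> and \<open>{d. f d \<noteq> y}\<close>. The relation is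
  reflexive off the vertex set too, so comparisons with components assume vertices.\<close>

definition link :: "('v, 'e) pre_digraph \<Rightarrow> 'e set \<Rightarrow> 'v rel" where
  "link G A = (\<Union>e\<in>arcs G \<inter> A. {(tail G e, head G e), (head G e, tail G e)})\<^sup>*"

lemma link_refl [simp]: "(u, u) \<in> link G A"
  by (simp add: link_def)

lemma link_trans: "(u, v) \<in> link G A \<Longrightarrow> (v, w) \<in> link G A \<Longrightarrow> (u, w) \<in> link G A"
  by (simp add: link_def)

lemma link_sym: "(u, v) \<in> link G A \<Longrightarrow> (v, u) \<in> link G A"
  unfolding link_def by (rule symD[OF sym_rtrancl]) (auto simp: sym_def)

lemma link_mono: "A \<subseteq> B \<Longrightarrow> (u, v) \<in> link G A \<Longrightarrow> (u, v) \<in> link G B"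
  unfolding link_def by (erule rtrancl_mono[THEN subsetD, rotated]) auto

lemma link_arc: "e \<in> arcs G \<Longrightarrow> e \<in> A \<Longrightarrow> (tail G e, head G e) \<in> link G A"
  and link_arc': "e \<in> arcs G \<Longrightarrow> e \<in> A \<Longrightarrow> (head G e, tail G e) \<in> link G A"
  unfolding link_def by (auto intro!: r_into_rtrancl)

lemma link_induct [consumes 1, case_names refl forward backward]:
  assumes "(u, v) \<in> link G A" and "P u"
    and "\<And>e. \<lbrakk>e \<in> arcs G; e \<in> A; (u, tail G e) \<in> link G A; P (tail G e)\<rbrakk> \<Longrightarrow> P (head G e)"
    and "\<And>e. \<lbrakk>e \<in> arcs G; e \<in> A; (u, head G e) \<in> link G A; P (head G e)\<rbrakk> \<Longrightarrow> P (tail G e)"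
  shows "P v"
  using assms(1) unfolding link_def
  by (induction rule: rtrancl_induct)
    (use assms(2-4) in \<open>auto simp: link_def[symmetric]\<close>)

lemma link_del_arc: "link (pre_digraph.del_arc G e) UNIV = link G (- {e})"
  by (simp add: link_def pre_digraph.del_arc_def Diff_eq)

text \<open>A path from \<open>u\<close> that used \<open>e\<close> would show that both ends of
  \<open>e\<close> are linked to \<open>u\<close>.\<close>

lemma link_avoid:
  assumes "(u, v) \<in> link G A" "(u, tail G e) \<notin> link G A \<or> (u, head G e) \<notin> link G A"
  shows "(u, v) \<in> link G (A - {e})"
  using assms(1)
proof (induction rule: link_induct)
  case (forward d)
  have "d \<noteq> e" using forward assms(2) link_arc link_trans by metis
  then have "(tail G d, head G d) \<in> link G (A - {e})"
    using forward by (intro link_arc) auto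
  then show ?case by (rule link_trans[OF forward(4)])
next
  case (backward d)
  have "d \<noteq> e" using backward assms(2) link_arc' link_trans by metis
  then have "(head G d, tail G d) \<in> link G (A - {e})"
    using backward by (intro link_arc') auto
  then show ?case by (rule link_trans[OF backward(4)])
qed simp

section \<open>Walks in the underlying undirected graph; forests as graphs whose arcs are all
  bridges\<close>

lemma two_way_simps:
  "verts (two_way G) = verts G" "arcs (two_way G) = arcs G \<times> UNIV"
  "tail (two_way G) (e, b) = (if b then tail G e else head G e)"
  "head (two_way G) (e, b) = (if b then head G e else tail G e)"
  by (simp_all add: two_way_def)

context
  fixes G :: "('v, 'e) pre_digraph"
  assumes wf: "wf_digraph G"
begin

interpretation S: pair_wf_digraph "mk_symmetric G"
  by (rule wf_digraph.wellformed_mk_symmetric[OF wf])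

lemma component_of_eq:
  assumes "u \<in> verts G"
  shows "component_of G u = {v. (u, v) \<in> link G UNIV}"
proof -
  have "link G UNIV = (parcs (mk_symmetric G))\<^sup>*"
    by (simp add: link_def parcs_mk_symmetric)
  moreover have "u \<rightarrow>\<^sup>*\<^bsub>mk_symmetric G\<^esub> v" if "(u, v) \<in> (parcs (mk_symmetric G))\<^sup>*" for v
    using that assms
    by (induction rule: rtrancl_induct) (auto intro: S.reachable_adj_trans)
  moreover have "(u, v) \<in> (parcs (mk_symmetric G))\<^sup>*"
    if "u \<rightarrow>\<^sup>*\<^bsub>mk_symmetric G\<^esub> v" for v
    using that reachable_rtranclI[of "with_proj (mk_symmetric G)"] by simp
  moreover have "v \<rightarrow>\<^sup>*\<^bsub>mk_symmetric G\<^esub> u" if "u \<rightarrow>\<^sup>*\<^bsub>mk_symmetric G\<^esub> v" for v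
    using that symmetric_mk_symmetric symmetric_reachable by metis
  ultimately show ?thesis
    unfolding component_of_def pre_digraph.scc_of_def by blast
qed

lemma component_of_eq_iff:
  assumes "u \<in> verts G" "v \<in> verts G"
  shows "component_of G u = component_of G v \<longleftrightarrow> (u, v) \<in> link G UNIV"
  by (simp add: component_of_eq assms set_eq_iff) (metis link_refl link_sym link_trans)

lemma components_eq: "components G = component_of G ` verts G"
  using S.sccs_verts_conv_scc_of unfolding components_def component_of_def by simp

lemma wf_two_way: "wf_digraph (two_way G)"
  using wf by (auto simp: wf_digraph_def two_way_def)

interpretation W: wf_digraph "two_way G"
  by (rule wf_two_way)

lemma awalk_two_way_link:
  assumes "W.awalk u p v" "fst ` set p \<subseteq> A"
  shows "(u, v) \<in> link G A"
  using assms
proof (induction p arbitrary: u)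
  case (Cons d p)
  obtain e b where d: "d = (e, b)" by force
  have w: "d \<in> arcs (two_way G)" "u = tail (two_way G) d" "W.awalk (head (two_way G) d) p v"
    using Cons.prems(1) by (auto simp: W.awalk_Cons_iff)
  then have "(u, head (two_way G) d) \<in> link G A"
    using d Cons.prems(2) by (cases b) (auto simp: two_way_simps intro: link_arc link_arc')
  then show ?case using Cons.IH[OF w(3)] Cons.prems(2) link_trans by auto
qed (simp add: W.awalk_Nil_iff)

lemma link_awalk_two_way:
  assumes "(u, v) \<in> link G A" "u \<in> verts G"
  shows "\<exists>p. W.awalk u p v \<and> fst ` set p \<subseteq> A"
  using assms(1)
proof (induction rule: link_induct)
  case refl
  then show ?case
    using assms(2) by (intro exI[of _ "[]"]) (simp add: W.awalk_Nil_iff two_way_simps)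
next
  case (forward e)
  then obtain p where p: "W.awalk u p (tail G e)" "fst ` set p \<subseteq> A" by blast
  have "W.awalk (tail G e) [(e, True)] (head G e)"
    using forward wf by (auto simp: W.awalk_Cons_iff W.awalk_Nil_iff two_way_simps wf_digraph_def)
  with p forward show ?case by (intro exI[of _ "p @ [(e, True)]"]) (auto intro: W.awalk_appendI)
next
  case (backward e)
  then obtain p where p: "W.awalk u p (head G e)" "fst ` set p \<subseteq> A" by blast
  have "W.awalk (head G e) [(e, False)] (tail G e)"
    using backward wf by (auto simp: W.awalk_Cons_iff W.awalk_Nil_iff two_way_simps wf_digraph_def)
  with p backward show ?case by (intro exI[of _ "p @ [(e, False)]"]) (auto intro: W.awalk_appendI)
qed

text \<open>Traversing the first arc a second time, in whichever direction, would visit its starting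
  vertex again.\<close>

lemma distinct_arcs_apath_two_way:
  assumes "W.apath u p v"
  shows "distinct (map fst p)"
  using assms
proof (induction p arbitrary: u)
  case (Cons d p)
  obtain e b where d: "d = (e, b)" by force
  have w: "u = tail (two_way G) d" "W.apath (head (two_way G) d) p v"
      "W.awalk (head (two_way G) d) p v" "u \<notin> set (W.awalk_verts (head (two_way G) d) p)"
    using Cons.prems W.awalkI_apath by (auto simp only: W.apath_Cons_iff)
  have "e \<notin> fst ` set p"
  proof
    assume "e \<in> fst ` set p"
    then obtain c where c: "(e, c) \<in> set p" by auto
    have "tail (two_way G) (e, c) \<in> set (W.awalk_verts (head (two_way G) d) p)"
        "head (two_way G) (e, c) \<in> set (W.awalk_verts (head (two_way G) d) p)"
      by (rule W.awalk_verts_arc1[OF c] W.awalk_verts_arc2[OF w(3) c])+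
    then show False using w(1,4) d by (cases b; cases c) (auto simp: two_way_simps)
  qed
  then show ?case using Cons.IH[OF w(2)] d by simp
qed simp

text \<open>A path from the head to the tail of \<open>e\<close> that avoids \<open>e\<close> can be
  made simple and then closes up with \<open>e\<close> to a cycle; conversely, a cycle without one
  of its arcs is such a path. A loop fails to be a bridge because \<open>link\<close> is
  reflexive.\<close>

lemma undirected_forest_iff:
  "undirected_forest G \<longleftrightarrow> (\<forall>e\<in>arcs G. (tail G e, head G e) \<notin> link G (- {e}))"
proof
  assume forest: "undirected_forest G"
  show "\<forall>e\<in>arcs G. (tail G e, head G e) \<notin> link G (- {e})"
  proof (intro ballI notI)
    fix e assume e: "e \<in> arcs G" and "(tail G e, head G e) \<in> link G (- {e})"
    then obtain p0 where p0: "W.awalk (head G e) p0 (tail G e)" "fst ` set p0 \<subseteq> - {e}"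
      using link_awalk_two_way[OF link_sym] wf by (metis wf_digraph.head_in_verts)
    obtain p where p: "W.apath (head G e) p (tail G e)" "fst ` set p \<subseteq> - {e}"
      by - (rule that[OF W.apath_awalk_to_apath[OF p0(1)] order_trans[OF image_mono]],
        rule W.awalk_to_apath_subset[OF p0(1)], rule p0(2))
    have "W.cycle ((e, True) # p)"
      unfolding W.cycle_def
    proof (intro exI conjI)
      show "W.awalk (tail G e) ((e, True) # p) (tail G e)"
        using p(1) e unfolding W.apath_def by (auto simp: W.awalk_Cons_iff two_way_simps)
      show "distinct (tl (W.awalk_verts (tail G e) ((e, True) # p)))"
        using p(1) unfolding W.apath_def by (simp add: two_way_simps)
    qed simp
    moreover have "distinct (map fst ((e, True) # p))"
      using distinct_arcs_apath_two_way[OF p(1)] p(2) by auto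
    ultimately show False using forest unfolding undirected_forest_def by blast
  qed
next
  assume bridges: "\<forall>e\<in>arcs G. (tail G e, head G e) \<notin> link G (- {e})"
  show "undirected_forest G"
    unfolding undirected_forest_def
  proof (intro notI, elim exE conjE)
    fix c assume c: "W.cycle c" "distinct (map fst c)"
    then obtain u d p where d: "c = d # p" "W.awalk u (d # p) u"
      unfolding W.cycle_def by (cases c) auto
    obtain e b where eb: "d = (e, b)" by force
    have w: "d \<in> arcs (two_way G)" "u = tail (two_way G) d" "W.awalk (head (two_way G) d) p u"
      using d(2) by (auto simp: W.awalk_Cons_iff)
    have "fst ` set p \<subseteq> - {e}" using c(2) d eb by auto
    then have "(head (two_way G) d, u) \<in> link G (- {e})"
      using awalk_two_way_link[OF w(3)] by blast
    then have "(tail G e, head G e) \<in> link G (- {e})"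
      using w(2) eb by (cases b) (auto simp: two_way_simps intro: link_sym)
    then show False using bridges w(1) eb by (auto simp: two_way_simps)
  qed
qed

end


section \<open>The graphs of an open relation\<close>

locale open_relation = bidirected_digraph D r
  for D :: "('a, 'b) pre_digraph" and r :: "'b \<Rightarrow> 'b" +
  fixes R :: "'b rel"
  assumes equiv: "equiv (arcs D) R"
begin

abbreviation CR :: "'b rel" where "CR \<equiv> closed_rel D r R"
abbreviation VG :: "(('a, 'b) vertex_vertex, 'b) pre_digraph" where "VG \<equiv> vertex_graph D r R"
abbreviation EG :: "('b edge_vertex, 'b) pre_digraph" where "EG \<equiv> edge_graph D r R"
abbreviation ov :: "'b \<Rightarrow> ('a, 'b) vertex_vertex" where "ov e \<equiv> Vertex (tail D e)"
abbreviation cv :: "'b \<Rightarrow> ('a, 'b) vertex_vertex" where "cv e \<equiv> VClosed_Class (CR `` {e})"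

text \<open>Lying in one component of the edge graph (\<open>link_EG_iff\<close>), stated on edges
  instead of classes. Anything that is not an arc is related to itself only.\<close>

definition same_edge :: "'b rel" where "same_edge = (R \<union> CR)\<^sup>*"

lemma R_arcs: "(a, b) \<in> R \<Longrightarrow> a \<in> arcs D" "(a, b) \<in> R \<Longrightarrow> b \<in> arcs D"
  using equiv by (auto simp: equiv_def refl_on_def)

lemma R_refl: "a \<in> arcs D \<Longrightarrow> (a, a) \<in> R"
  and R_sym: "(a, b) \<in> R \<Longrightarrow> (b, a) \<in> R"
  and R_trans: "(a, b) \<in> R \<Longrightarrow> (b, c) \<in> R \<Longrightarrow> (a, c) \<in> R"
  using equiv by (auto simp: equiv_def refl_on_def elim: symE transE)

lemma CR_iff: "(a, b) \<in> CR \<longleftrightarrow> a \<in> arcs D \<and> b \<in> arcs D \<and> (r a, r b) \<in> R"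
  by (simp add: closed_rel_def)

lemma CR_arev: "(r a, r b) \<in> CR \<longleftrightarrow> (a, b) \<in> R"
  using R_arcs by (auto simp: CR_iff arev_arev arev_in_arcs_iff)

lemma equiv_CR: "equiv (arcs D) CR"
  unfolding equiv_def
proof (intro conjI)
  show "refl_on (arcs D) CR"
    by (auto simp: refl_on_def CR_iff arev_in_arcs_iff intro: R_refl)
  show "sym CR"
    by (auto simp: sym_def CR_iff intro: R_sym)
  show "trans CR"
    unfolding trans_def CR_iff using R_trans by blast
qed (auto simp: CR_iff)

lemma CR_refl: "a \<in> arcs D \<Longrightarrow> (a, a) \<in> CR"
  and CR_sym: "(a, b) \<in> CR \<Longrightarrow> (b, a) \<in> CR"
  and CR_trans: "(a, b) \<in> CR \<Longrightarrow> (b, c) \<in> CR \<Longrightarrow> (a, c) \<in> CR"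
  using equiv_CR by (auto simp: equiv_def refl_on_def elim: symE transE)

lemma R_class_eq_iff: "a \<in> arcs D \<Longrightarrow> b \<in> arcs D \<Longrightarrow> R `` {a} = R `` {b} \<longleftrightarrow> (a, b) \<in> R"
  by (rule eq_equiv_class_iff[OF equiv])

lemma CR_class_eq_iff: "a \<in> arcs D \<Longrightarrow> b \<in> arcs D \<Longrightarrow> CR `` {a} = CR `` {b} \<longleftrightarrow> (a, b) \<in> CR"
  by (rule eq_equiv_class_iff[OF equiv_CR])

lemma VG_simps [simp]: "arcs VG = arcs D" "tail VG e = ov e" "head VG e = cv e"
  and EG_simps [simp]: "arcs EG = arcs D" "tail EG e = Open_Class (R `` {e})"
    "head EG e = Closed_Class (CR `` {e})"
  by (simp_all add: vertex_graph_def edge_graph_def)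

lemma verts_VG: "verts VG = Vertex ` verts D \<union> cv ` arcs D"
  and verts_EG: "verts EG = (\<lambda>e. Open_Class (R `` {e})) ` arcs D \<union>
    (\<lambda>e. Closed_Class (CR `` {e})) ` arcs D"
  by (auto simp: vertex_graph_def edge_graph_def quotient_def)

lemma wf_VG: "wf_digraph VG"
  by unfold_locales (auto simp: verts_VG)

lemma wf_EG: "wf_digraph EG"
  by unfold_locales (auto simp: verts_EG)

lemma ov_in_verts: "e \<in> arcs D \<Longrightarrow> ov e \<in> verts VG"
  by (simp add: verts_VG)

lemma open_in_verts: "e \<in> arcs D \<Longrightarrow> Open_Class (R `` {e}) \<in> verts EG"
  by (simp add: verts_EG)

lemma link_VG: "e \<in> arcs D \<Longrightarrow> e \<in> A \<Longrightarrow> (ov e, cv e) \<in> link VG A"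
  "e \<in> arcs D \<Longrightarrow> e \<in> A \<Longrightarrow> (cv e, ov e) \<in> link VG A"
  using link_arc[of e VG A] link_arc'[of e VG A] by simp_all

lemma link_VG_CR:
  assumes "(a, b) \<in> CR" "a \<in> A" "b \<in> A"
  shows "(ov a, ov b) \<in> link VG A"
proof -
  have "a \<in> arcs D" "b \<in> arcs D" "cv a = cv b"
    using assms CR_class_eq_iff by (auto simp: CR_iff)
  then show ?thesis using link_VG assms link_trans by metis
qed

lemma same_edge_refl [simp]: "(a, a) \<in> same_edge"
  and same_edge_trans: "(a, b) \<in> same_edge \<Longrightarrow> (b, c) \<in> same_edge \<Longrightarrow> (a, c) \<in> same_edge"
  and same_edge_R: "(a, b) \<in> R \<Longrightarrow> (a, b) \<in> same_edge"
  and same_edge_CR: "(a, b) \<in> CR \<Longrightarrow> (a, b) \<in> same_edge"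
  by (auto simp: same_edge_def)

lemma same_edge_sym: "(a, b) \<in> same_edge \<Longrightarrow> (b, a) \<in> same_edge"
  unfolding same_edge_def
  by (rule symD[OF sym_rtrancl]) (auto simp: sym_def intro: R_sym CR_sym)

lemma same_edge_arev: "(a, b) \<in> same_edge \<Longrightarrow> (r a, r b) \<in> same_edge"
  unfolding same_edge_def
proof (induction rule: rtrancl_induct)
  case (step b c)
  then have "(r b, r c) \<in> R \<union> CR" using CR_arev[of b c] by (auto simp: CR_iff[of b c])
  with step.IH show ?case by (rule rtrancl_into_rtrancl)
qed simp

lemma same_edge_arcs: "(a, b) \<in> same_edge \<Longrightarrow> a \<in> arcs D \<Longrightarrow> b \<in> arcs D"
  unfolding same_edge_def by (induction rule: rtrancl_induct) (auto simp: CR_iff dest: R_arcs)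

lemma same_edge_no_arc: "(a, b) \<in> same_edge \<Longrightarrow> a \<notin> arcs D \<Longrightarrow> b = a"
  unfolding same_edge_def by (induction rule: rtrancl_induct) (auto simp: CR_iff dest: R_arcs)

lemma link_EG_iff:
  assumes "a \<in> arcs D" "b \<in> arcs D"
  shows "(Open_Class (R `` {a}), Open_Class (R `` {b})) \<in> link EG UNIV \<longleftrightarrow> (a, b) \<in> same_edge"
proof
  \<comment> \<open>The invariant along the path: every member of a class that is reached is in the
    component of \<open>a\<close>.\<close>
  define P where "P x = (case x of Open_Class X \<Rightarrow> \<forall>c\<in>X. (a, c) \<in> same_edge
    | Closed_Class X \<Rightarrow> \<forall>c\<in>X. (a, c) \<in> same_edge)" for x
  assume "(Open_Class (R `` {a}), Open_Class (R `` {b})) \<in> link EG UNIV"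
  then have "P (Open_Class (R `` {b}))"
  proof (induction rule: link_induct)
    case refl
    then show ?case by (auto simp: P_def intro: same_edge_R)
  next
    case (forward d)
    then have "(a, d) \<in> same_edge" using R_refl by (auto simp: P_def)
    then show ?case by (auto simp: P_def intro: same_edge_trans same_edge_CR)
  next
    case (backward d)
    then have "(a, d) \<in> same_edge" using CR_refl by (auto simp: P_def)
    then show ?case by (auto simp: P_def intro: same_edge_trans same_edge_R)
  qed
  then show "(a, b) \<in> same_edge" using R_refl[OF assms(2)] by (auto simp: P_def)
next
  assume "(a, b) \<in> same_edge"
  then show "(Open_Class (R `` {a}), Open_Class (R `` {b})) \<in> link EG UNIV"
    unfolding same_edge_def
  proof (induction rule: rtrancl_induct)
    case (step b c)
    have bc: "b \<in> arcs D" "c \<in> arcs D" using step(2) R_arcs by (auto simp: CR_iff)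
    have "(Open_Class (R `` {b}), Open_Class (R `` {c})) \<in> link EG UNIV"
    proof (cases "(b, c) \<in> R")
      case True
      then have "R `` {b} = R `` {c}" using R_class_eq_iff bc by blast
      then show ?thesis by simp
    next
      case False
      then have "CR `` {b} = CR `` {c}" using step(2) CR_class_eq_iff bc by blast
      then show ?thesis
        using link_arc[of b EG UNIV] link_arc'[of c EG UNIV] bc link_trans by fastforce
    qed
    with step.IH show ?case by (rule link_trans)
  qed simp
qed

lemma quotient_edge_map_eq_iff:
  assumes "a \<in> arcs D" "b \<in> arcs D"
  shows "quotient_edge_map D r R a = quotient_edge_map D r R b \<longleftrightarrow> (a, b) \<in> same_edge"
  unfolding quotient_edge_map_def
  using assms link_EG_iff component_of_eq_iff[OF wf_EG] open_in_verts by simp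

lemma quotient_vertex_map_eq_iff:
  assumes "u \<in> verts D" "v \<in> verts D"
  shows "quotient_vertex_map D r R u = quotient_vertex_map D r R v \<longleftrightarrow>
    (Vertex u, Vertex v) \<in> link VG UNIV"
  unfolding quotient_vertex_map_def
  using assms component_of_eq_iff[OF wf_VG] by (simp add: verts_VG)

end


section \<open>From essential origamis to injectivity\<close>

locale tree_relation = open_relation +
  assumes bridge: "e \<in> arcs D \<Longrightarrow> (ov e, cv e) \<notin> link VG (- {e})"
    and local_consistency: "(e1, e2) \<in> R \<Longrightarrow> (ov e1, ov e2) \<in> link VG (- {e1})"
begin

text \<open>Deleting an edge of the forest separates an open side, containing its initial vertex,
  from a closed side. Here \<open>e\<close> and \<open>e'\<close> share their closed vertex, and a
  path on the open side of \<open>e'\<close> never reaches that vertex, so it cannot use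
  \<open>e\<close>.\<close>

lemma open_side_in_closed_side:
  assumes ee': "(e, e') \<in> CR" "e \<noteq> e'" and x: "(ov e', x) \<in> link VG (- {e'})"
  shows "(cv e, x) \<in> link VG (- {e})"
proof -
  have arcs: "e \<in> arcs D" "e' \<in> arcs D" using ee' by (auto simp: CR_iff)
  then have cv: "cv e = cv e'" using ee' CR_class_eq_iff by simp
  have "(ov e', head VG e) \<notin> link VG (- {e'})" using bridge[OF arcs(2)] cv by simp
  then have "(ov e', x) \<in> link VG (- {e'} - {e})" using link_avoid[OF x] by blast
  then have "(ov e', x) \<in> link VG (- {e})" by (rule link_mono[rotated]) auto
  moreover have "(cv e', ov e') \<in> link VG (- {e})" using link_VG(2)[OF arcs(2)] ee'(2) by auto
  ultimately show ?thesis using cv link_trans by metis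
qed

text \<open>Neither \<open>d\<close> nor \<open>e\<close> separates their initial vertices. So
  \<open>ov e\<close> is on the open side of \<open>d\<close>, and a path on the closed side of
  \<open>d\<close> cannot use \<open>e\<close>.\<close>

lemma closed_side_in_open_side:
  assumes "d \<in> arcs D" "d \<noteq> e" and de: "(ov e, ov d) \<in> link VG (- {e})" "(ov d, ov e) \<in> link VG (- {d})"
    and x: "(cv d, x) \<in> link VG (- {d})"
  shows "(ov e, x) \<in> link VG (- {e})"
proof -
  have "(cv d, tail VG e) \<notin> link VG (- {d})"
  proof
    assume "(cv d, tail VG e) \<in> link VG (- {d})"
    then have "(ov e, cv d) \<in> link VG (- {d})" by (simp add: link_sym)
    then show False using bridge[OF assms(1)] de(2) link_trans by metis
  qed
  then have "(cv d, x) \<in> link VG (- {d} - {e})" using link_avoid[OF x] by blast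
  then have "(cv d, x) \<in> link VG (- {e})" by (rule link_mono[rotated]) auto
  moreover have "(ov d, cv d) \<in> link VG (- {e})" using link_VG(1)[OF assms(1)] assms(2) by auto
  ultimately show ?thesis using de(1) link_trans by metis
qed

text \<open>\<open>zigzag d e\<close>: a path without backtracking in the edge graph that starts at the open class
  of \<open>d\<close>, first traverses \<open>d\<close>, and ends at the open class of \<open>e\<close>.\<close>

inductive zigzag :: "'b \<Rightarrow> 'b \<Rightarrow> bool" where
  last: "(d, d') \<in> CR \<Longrightarrow> d' \<noteq> d \<Longrightarrow> (d', e) \<in> R \<Longrightarrow> zigzag d e"
| step: "(d, d') \<in> CR \<Longrightarrow> d' \<noteq> d \<Longrightarrow> (d', d'') \<in> R \<Longrightarrow> d'' \<noteq> d' \<Longrightarrow> zigzag d'' e \<Longrightarrow> zigzag d e"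

text \<open>The two inclusions of sides apply alternately along the zigzag, so its end never leaves
  the closed side of its first edge.\<close>

lemma zigzag_closed_side: "zigzag d e \<Longrightarrow> (cv d, ov e) \<in> link VG (- {d})"
proof (induction rule: zigzag.induct)
  case (last d d' e)
  then show ?case using open_side_in_closed_side[of d d'] local_consistency by simp
next
  case (step d d' d'' e)
  then have "(ov d', ov e) \<in> link VG (- {d'})"
    using closed_side_in_open_side[of d'' d'] local_consistency R_sym R_arcs by blast
  then show ?case using open_side_in_closed_side[of d d'] step by simp
qed

lemma same_edge_zigzag:
  assumes "(e, e') \<in> same_edge" "e' \<in> arcs D"
  shows "(e, e') \<in> R \<or> (\<exists>d. (e, d) \<in> R \<and> zigzag d e')"
  using assms(1) unfolding same_edge_def
proof (induction rule: converse_rtrancl_induct)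
  case base
  then show ?case using R_refl assms(2) by simp
next
  case (step a b)
  have arcs: "a \<in> arcs D" "b \<in> arcs D" using step(1) R_arcs by (auto simp: CR_iff)
  show ?case
  proof (cases "(a, b) \<in> R \<or> a = b")
    case True
    then show ?thesis using step.IH R_trans by blast
  next
    case False
    then have ab: "(a, b) \<in> CR" "b \<noteq> a" using step(1) by auto
    from step.IH show ?thesis
    proof (elim disjE exE conjE)
      assume "(b, e') \<in> R"
      then show ?thesis using zigzag.last ab R_refl arcs by blast
    next
      fix d assume d: "(b, d) \<in> R" "zigzag d e'"
      show ?thesis
      proof (cases "d = b")
        case False
        then show ?thesis using zigzag.step[OF ab d(1) _ d(2)] R_refl arcs by blast
      next
        \<comment> \<open>The zigzag starts with \<open>b\<close> itself, so prepending
          \<open>a\<close> would produce two consecutive closed steps. They are composed into one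
          from \<open>a\<close> to \<open>d'\<close>, which disappears when
          \<open>d' = a\<close>.\<close>
        case True
        from d(2) show ?thesis
        proof cases
          case (last d')
          then have "(a, d') \<in> CR" using ab(1) True CR_trans by blast
          then show ?thesis using last zigzag.last[of a d' e'] R_refl arcs by (cases "d' = a") auto
        next
          case (step d' d'')
          then have "(a, d') \<in> CR" using ab(1) True CR_trans by blast
          then show ?thesis
            using step zigzag.step[of a d' d'' e'] R_refl arcs by (cases "d' = a") auto
        qed
      qed
    qed
  qed
qed

text \<open>Otherwise a zigzag starting with some \<open>d\<close> in the open class of
  \<open>e\<close> puts \<open>ov e'\<close> on the closed side of \<open>d\<close>, whereas the
  given path avoids \<open>d\<close> and keeps it on the open side.\<close>

lemma open_equivalent_if_linked_avoiding_edge: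
  assumes "e' \<in> arcs D" and same: "(e, e') \<in> same_edge"
    and "(ov e, ov e') \<in> link VG {d. (e, d) \<notin> same_edge}"
  shows "(e, e') \<in> R"
proof (rule ccontr)
  assume "(e, e') \<notin> R"
  then obtain d where d: "(e, d) \<in> R" "zigzag d e'"
    using same_edge_zigzag[OF same assms(1)] by blast
  then have "{d. (e, d) \<notin> same_edge} \<subseteq> - {d}" using same_edge_R by blast
  then have "(ov e, ov e') \<in> link VG (- {d})" using assms(3) link_mono by metis
  moreover have "(ov d, ov e) \<in> link VG (- {d})" using local_consistency R_sym d(1) by metis
  moreover have "(ov e', cv d) \<in> link VG (- {d})" using zigzag_closed_side d(2) link_sym by metis
  ultimately have "(ov d, cv d) \<in> link VG (- {d})" using link_trans by metis
  then show False using bridge R_arcs d(1) by metis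
qed

end

text \<open>Compatibility expressed on the edges of \<open>D\<close>: \<open>f\<close> is constant
  on components of the edge graph, and \<open>immersed\<close> is injectivity of the factor map on
  the edges leaving one component of the vertex graph.\<close>

locale immersed_tree_relation = tree_relation D r R
  for D :: "('a, 'b) pre_digraph" and r :: "'b \<Rightarrow> 'b" and R :: "'b rel" +
  fixes s :: "'d \<Rightarrow> 'd" and f :: "'b \<Rightarrow> 'd"
  assumes s_inv: "s (s y) = y"
    and f_arev: "e \<in> arcs D \<Longrightarrow> f (r e) = s (f e)"
    and f_same_edge: "(e1, e2) \<in> same_edge \<Longrightarrow> f e1 = f e2"
    and immersed: "\<lbrakk>e1 \<in> arcs D; e2 \<in> arcs D; (ov e1, ov e2) \<in> link VG UNIV; f e1 = f e2\<rbrakk>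
      \<Longrightarrow> (e1, e2) \<in> same_edge"
begin

text \<open>Lift the image walk to the universal cover: these are the letters read while the lift is
  at its starting point. They bound the letters that the path in \<open>VG\<close> may use.\<close>

definition outer_letters :: "'b list \<Rightarrow> 'd set" where
  "outer_letters p = {f e | a e b. p = a @ e # b \<and> free_red s (map f a) = []}"

text \<open>A null-homotopic image word splits as \<open>f e \<cdot> f p1 \<cdot> (f e)\<^sup>* \<cdot> f p2\<close>, and taking \<open>p1\<close> as short as
  possible makes the path in \<open>VG\<close> spanned by \<open>p1\<close> avoid all edges identified with \<open>e\<^sup>*\<close>. Then \<open>e\<close>
  and its partner are closed-equivalent but distinct, so that every such excursion advances
  through the forest \<open>VG\<close> without backtracking.\<close>

lemma reduced_null_walk:
  assumes "awalk u p v" "reduced r p" "free_red s (map f p) = []" "p \<noteq> []"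
  shows "(cv (hd p), Vertex v) \<in> link VG (- {hd p}) \<and>
    (Vertex u, Vertex v) \<in> link VG {d. f d \<in> outer_letters p}"
  using assms
proof (induction "length p" arbitrary: u p v rule: less_induct)
  case less
  obtain e w where p: "p = e # w" using less.prems(4) by (cases p) auto
  have e: "e \<in> arcs D" "tail D e = u" "awalk (head D e) w v"
    using less.prems(1) p by (auto simp: awalk_Cons_iff)
  obtain t t' where t: "map f w = t @ s (f e) # t'" "free_red s t = []" "free_red s t' = []"
      "\<And>t1 t2. t = t1 @ s (f e) # t2 \<Longrightarrow> free_red s t1 \<noteq> []"
    using null_word_split[of s "f e" "map f w", OF s_inv] less.prems(3) p by auto
  then obtain p1 e' p2 where w: "w = p1 @ e' # p2" "map f p1 = t" "f e' = s (f e)" "map f p2 = t'"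
    by (auto simp: map_eq_append_conv map_eq_Cons_conv)
  have e': "e' \<in> arcs D" and p1: "awalk (head D e) p1 (tail D e')" and p2: "awalk (head D e') p2 v"
    using e(3) w(1) by (auto simp: awalk_Cons_iff awalk_append_iff)
  have red: "reduced r p1" "reduced r p2"
    using less.prems(2) unfolding p w(1) by (auto simp: successively_append_iff successively_Cons)
  have IH1: "(cv (hd p1), ov e') \<in> link VG (- {hd p1}) \<and>
      (ov (r e), ov e') \<in> link VG {d. f d \<in> outer_letters p1}" if "p1 \<noteq> []"
    using less.hyps[of p1, OF _ p1 red(1) _ that] p w t e(1) by simp
  have "(ov (r e), ov e') \<in> link VG {d. f d \<in> outer_letters p1}"
    using IH1 p1 e(1) by (cases "p1 = []") (auto simp: awalk_Nil_iff)
  \<comment> \<open>This is the minimality of the excursion \<open>p1\<close>.\<close>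
  moreover have "s (f e) \<notin> outer_letters p1"
    using t(4) w(2) by (auto simp: outer_letters_def)
  ultimately have avoid: "(ov (r e), ov e') \<in> link VG {d. f d \<noteq> s (f e)}"
    by (elim link_mono[rotated]) auto
  have same: "(r e, e') \<in> same_edge"
    using immersed[of "r e" e', OF _ e' link_mono[OF subset_UNIV avoid]] e(1) w(3) f_arev
    by (simp add: arev_in_arcs_iff)
  have "{d. f d \<noteq> s (f e)} \<subseteq> {d. (r e, d) \<notin> same_edge}"
    using f_same_edge[of "r e"] f_arev[OF e(1)] by auto
  then have "(r e, e') \<in> R"
    by (intro open_equivalent_if_linked_avoiding_edge[OF e' same] link_mono[OF _ avoid])
  then have CR: "(e, r e') \<in> CR" using e(1) e' by (simp add: CR_iff arev_in_arcs_iff arev_arev)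
  \<comment> \<open>Equality would make \<open>e'\<close> the reverse of \<open>e\<close> and
    \<open>p1\<close> a closed walk. If \<open>p1\<close> is empty, this is a backtrack; otherwise
    the induction hypothesis for \<open>p1\<close> contradicts the bridge property of its first
    edge.\<close>
  have neq: "e \<noteq> r e'"
  proof
    assume eq: "e = r e'"
    show False
    proof (cases "p1 = []")
      case True
      then have "e' \<noteq> r e" using less.prems(2) p w(1) by (simp add: successively_Cons)
      then show False using eq arev_arev by simp
    next
      case False
      then obtain d p1' where d: "p1 = d # p1'" by (cases p1) auto
      then have "d \<in> arcs D" "ov d = ov e'"
        using p1 eq e' by (auto simp: awalk_Cons_iff head_arev)
      then show False using IH1[OF False] d bridge[of d] link_sym by fastforce
    qed
  qed
  have re': "r e' \<in> arcs D" "ov (r e') = Vertex (head D e')" using e' by (auto simp: arev_in_arcs_iff)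
  have "f (r e') = f e" using f_arev[OF e'] w(3) s_inv by simp
  moreover have fe: "f e \<in> outer_letters p" unfolding outer_letters_def p by force
  ultimately have link1: "(Vertex u, ov (r e')) \<in> link VG {d. f d \<in> outer_letters p}"
    using link_VG_CR[OF CR] e(2) by simp
  \<comment> \<open>The rest \<open>p2\<close> starts at the initial vertex of \<open>r e'\<close>,
    and its first edge differs from \<open>r e'\<close> because \<open>p\<close> is reduced. Its
    path in \<open>VG\<close> thus stays on the open side of \<open>r e'\<close>.\<close>
  have I: "(ov (r e'), Vertex v) \<in> link VG (- {r e'}) \<and>
      (ov (r e'), Vertex v) \<in> link VG {d. f d \<in> outer_letters p}"
  proof (cases "p2 = []")
    case True
    then show ?thesis using p2 re' by (simp add: awalk_Nil_iff)
  next
    case False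
    then obtain d p2' where d: "p2 = d # p2'" by (cases p2) auto
    have d': "d \<in> arcs D" "ov d = ov (r e')" using p2 d re' by (auto simp: awalk_Cons_iff)
    have "d \<noteq> r e'"
      using less.prems(2) unfolding p w(1) d
      by (auto simp: successively_append_iff successively_Cons)
    have IH2: "(cv d, Vertex v) \<in> link VG (- {d})"
        "(Vertex (head D e'), Vertex v) \<in> link VG {d. f d \<in> outer_letters p2}"
      using less.hyps[of p2, OF _ p2 red(2) _ False] p w t d by auto
    \<comment> \<open>The part of \<open>p\<close> before \<open>p2\<close> has null image, so null
      prefixes of \<open>p2\<close> extend to null prefixes of \<open>p\<close>.\<close>
    have "outer_letters p2 \<subseteq> outer_letters p"
    proof
      fix y assume "y \<in> outer_letters p2"
      then obtain a b c where abc: "p2 = a @ b # c" "free_red s (map f a) = []" "y = f b"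
        unfolding outer_letters_def by blast
      then have "free_red s (map f (e # p1 @ e' # a)) = []"
        using free_red_cancel_inner[OF s_inv t(2), where x = "[]"] w by simp
      moreover have "p = (e # p1 @ e' # a) @ b # c" using p w(1) abc(1) by simp
      ultimately show "y \<in> outer_letters p" unfolding outer_letters_def using abc(3) by blast
    qed
    then have "(ov (r e'), Vertex v) \<in> link VG {d. f d \<in> outer_letters p}"
      using IH2(2) re'(2) by (auto elim: link_mono[rotated])
    then show ?thesis
      using closed_side_in_open_side[OF d'(1) \<open>d \<noteq> r e'\<close> _ _ IH2(1)] d'(2) by simp
  qed
  then have "(cv e, Vertex v) \<in> link VG (- {e})"
    using open_side_in_closed_side[OF CR neq] by blast
  then show ?case using I link1 link_trans p by fastforce
qed

lemma null_loop_trivial: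
  assumes "awalk x p x" "free_red s (map f p) = []"
  shows "free_red r p = []"
proof (rule ccontr)
  let ?p = "free_red r p"
  assume ne: "?p \<noteq> []"
  have w: "awalk x ?p x" by (rule awalk_free_red[OF assms(1)])
  have "set p \<subseteq> arcs D" using assms(1) by (simp add: awalk_def)
  then have "free_red s (map f ?p) = []"
    using free_red_map[of s p f r, OF s_inv f_arev] assms(2) by auto
  then have "(cv (hd ?p), Vertex x) \<in> link VG (- {hd ?p})"
    using reduced_null_walk[OF w reduced_free_red _ ne] by simp
  moreover obtain d p' where "?p = d # p'" using ne by (cases ?p) auto
  moreover from this w have "d \<in> arcs D" "tail D d = x" by (auto simp: awalk_Cons_iff)
  ultimately show False using bridge[of d] link_sym by fastforce
qed

end


section \<open>The quotient graph\<close>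

context open_relation
begin

abbreviation qV :: "'a \<Rightarrow> ('a, 'b) vertex_vertex set" where "qV \<equiv> quotient_vertex_map D r R"
abbreviation qE :: "'b \<Rightarrow> 'b edge_vertex set" where "qE \<equiv> quotient_edge_map D r R"

lemma components_VG: "components VG = qV ` verts D"
proof -
  have "component_of VG (cv e) = qV (tail D e)" if "e \<in> arcs D" for e
    unfolding quotient_vertex_map_def
    using that component_of_eq_iff[OF wf_VG, of "cv e" "ov e"] link_VG(2)[of e UNIV]
    by (simp add: verts_VG)
  then show ?thesis
    unfolding components_eq[OF wf_VG] verts_VG image_Un image_image
    by (auto simp: quotient_vertex_map_def)
qed

lemma component_of_closed_class:
  assumes "e \<in> arcs D"
  shows "component_of EG (Closed_Class (CR `` {e})) = qE e"
  unfolding quotient_edge_map_def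
  using assms component_of_eq_iff[OF wf_EG, of "Closed_Class (CR `` {e})" "Open_Class (R `` {e})"]
    link_arc'[of e EG UNIV]
  by (simp add: verts_EG)

lemma components_EG: "components EG = qE ` arcs D"
proof -
  have "components EG = (\<lambda>e. component_of EG (Open_Class (R `` {e}))) ` arcs D \<union>
      (\<lambda>e. component_of EG (Closed_Class (CR `` {e}))) ` arcs D"
    unfolding components_eq[OF wf_EG] verts_EG image_Un image_image by simp
  also have "\<dots> = qE ` arcs D"
    using component_of_closed_class by (simp add: quotient_edge_map_def)
  finally show ?thesis .
qed

lemma arev_image_R: "r ` (R `` {a}) = CR `` {r a}"
proof (intro equalityI subsetI)
  fix x assume "x \<in> CR `` {r a}"
  then have "r x \<in> R `` {a}" using CR_arev[of a "r x"] by (simp add: arev_arev)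
  then show "x \<in> r ` (R `` {a})" using arev_arev[of x] by force
qed (use CR_arev in auto)

lemma arev_image_CR: "r ` (CR `` {a}) = R `` {r a}"
  using arg_cong[OF arev_image_R[of "r a"], of "image r"] by (simp add: image_image arev_arev)

lemma swap_class_swap_class: "swap_class r (swap_class r x) = x"
  by (cases x) (simp_all add: image_image arev_arev)

text \<open>Together with \<open>r\<close> on arcs, \<open>swap_class\<close> is a symmetry of the
  edge graph that reverses the direction of every arc.\<close>

lemma link_EG_swap_class:
  assumes "(x, y) \<in> link EG UNIV"
  shows "(swap_class r x, swap_class r y) \<in> link EG UNIV"
  using assms
proof (induction rule: link_induct)
  case (forward e)
  have "(swap_class r (tail EG e), swap_class r (head EG e)) \<in> link EG UNIV"
    using link_arc'[of "r e" EG UNIV] forward(1)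
    by (simp add: arev_image_R arev_image_CR arev_in_arcs_iff)
  then show ?case by (rule link_trans[OF forward(4)])
next
  case (backward e)
  have "(swap_class r (head EG e), swap_class r (tail EG e)) \<in> link EG UNIV"
    using link_arc[of "r e" EG UNIV] backward(1)
    by (simp add: arev_image_R arev_image_CR arev_in_arcs_iff)
  then show ?case by (rule link_trans[OF backward(4)])
qed simp

lemma qE_eq: "e \<in> arcs D \<Longrightarrow> qE e = {x. (Open_Class (R `` {e}), x) \<in> link EG UNIV}"
  unfolding quotient_edge_map_def by (rule component_of_eq[OF wf_EG open_in_verts])

lemma swap_class_qE:
  assumes "e \<in> arcs D" "x \<in> qE e"
  shows "swap_class r x \<in> qE (r e)"
proof -
  have "(Closed_Class (CR `` {r e}), swap_class r x) \<in> link EG UNIV"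
    using link_EG_swap_class[of "Open_Class (R `` {e})" x] assms by (simp add: qE_eq arev_image_R)
  moreover have "(Open_Class (R `` {r e}), Closed_Class (CR `` {r e})) \<in> link EG UNIV"
    using link_arc[of "r e" EG UNIV] assms(1) by (simp add: arev_in_arcs_iff)
  ultimately have "(Open_Class (R `` {r e}), swap_class r x) \<in> link EG UNIV"
    by (rule link_trans[rotated])
  then show ?thesis using assms(1) by (simp add: qE_eq arev_in_arcs_iff)
qed

lemma quotient_rev_qE:
  assumes "e \<in> arcs D"
  shows "quotient_rev D r R (qE e) = qE (r e)"
proof -
  have "swap_class r ` qE e = qE (r e)"
  proof (intro equalityI subsetI)
    fix x assume "x \<in> qE (r e)"
    then have "swap_class r x \<in> qE e"
      using swap_class_qE[of "r e" x] assms by (simp add: arev_arev arev_in_arcs_iff)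
    then show "x \<in> swap_class r ` qE e" using swap_class_swap_class[of x] by (metis imageI)
  qed (use swap_class_qE[OF assms] in auto)
  then show ?thesis using assms components_EG by (simp add: quotient_rev_def)
qed

lemma same_edge_link:
  assumes "\<And>a b. (a, b) \<in> R \<Longrightarrow> (ov a, ov b) \<in> link VG UNIV" "(a, b) \<in> same_edge"
  shows "(ov a, ov b) \<in> link VG UNIV"
  using assms(2) unfolding same_edge_def
proof (induction rule: rtrancl_induct)
  case (step b c)
  then have "(ov b, ov c) \<in> link VG UNIV" using assms(1) link_VG_CR by blast
  with step.IH show ?case by (rule link_trans)
qed simp

text \<open>Global consistency, the first assumption, makes the definite description independent of
  the representative; closed-equivalent edges have initial vertices adjacent to a common closed
  vertex.\<close>

lemma quotient_tail_qE:
  assumes "\<And>a b. (a, b) \<in> R \<Longrightarrow> (ov a, ov b) \<in> link VG UNIV" "e \<in> arcs D"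
  shows "quotient_tail D r R (qE e) = qV (tail D e)"
  unfolding quotient_tail_def
proof (rule the_equality)
  fix X assume "\<exists>e'\<in>arcs D. qE e' = qE e \<and> X = qV (tail D e')"
  then obtain e' where e': "e' \<in> arcs D" "qE e' = qE e" "X = qV (tail D e')" by blast
  then have "(ov e', ov e) \<in> link VG UNIV"
    using same_edge_link[OF assms(1)] quotient_edge_map_eq_iff assms(2) by blast
  then show "X = qV (tail D e)"
    using e' quotient_vertex_map_eq_iff assms(2) by simp
qed (use assms(2) in auto)

lemma component_of_del_arc_eq_iff:
  assumes "e1 \<in> arcs D" "e2 \<in> arcs D"
  shows "component_of (pre_digraph.del_arc VG e) (ov e1) =
      component_of (pre_digraph.del_arc VG e) (ov e2) \<longleftrightarrow>
    (ov e1, ov e2) \<in> link VG (- {e})"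
proof -
  have "wf_digraph (pre_digraph.del_arc VG e)"
    by (rule wf_digraph.wf_digraph_del_arc[OF wf_VG])
  then show ?thesis
    using component_of_eq_iff[of "pre_digraph.del_arc VG e" "ov e1" "ov e2"] ov_in_verts assms
    by (simp add: link_del_arc pre_digraph.verts_del_arc)
qed

end

lemma essential_origami_compatible_imp_trivial_kernel:
  assumes D: "bidirected_digraph D r" and H: "bidirected_digraph H s"
    and f: "serre_morphism D r H s fV fE"
    and R: "essential_origami D r R" "origami_compatible D r H s fV fE R"
    and p: "pre_digraph.awalk D x p x" "free_red s (map fE p) = []"
  shows "free_red r p = []"
proof -
  interpret D: bidirected_digraph D r by fact
  interpret H: bidirected_digraph H s by fact
  have orig: "origami D r R" and forest: "undirected_forest (vertex_graph D r R)"
    using R(1) by (auto simp: essential_origami_def)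
  interpret open_relation D r R
    using orig by unfold_locales (simp add: origami_def)
  have gc: "(ov a, ov b) \<in> link VG UNIV" if "(a, b) \<in> R" for a b
    using orig that R_arcs[OF that] component_of_eq_iff[OF wf_VG] ov_in_verts
    by (auto simp: origami_def)
  obtain gV gE where g: "serre_immersion (quotient_graph D r R) (quotient_rev D r R) H s gV gE"
      "\<And>v. v \<in> verts D \<Longrightarrow> fV v = gV (qV v)" "\<And>e. e \<in> arcs D \<Longrightarrow> fE e = gE (qE e)"
    using R(2) unfolding origami_compatible_def by blast
  interpret immersed_tree_relation D r R s fE
  proof unfold_locales
    fix e assume "e \<in> arcs D"
    then show "(ov e, cv e) \<notin> link VG (- {e})"
      using forest undirected_forest_iff[OF wf_VG] by simp
  next
    fix e1 e2 assume e12: "(e1, e2) \<in> R"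
    then have "component_of (pre_digraph.del_arc VG e1) (ov e1) =
        component_of (pre_digraph.del_arc VG e1) (ov e2)"
      using orig R_arcs[OF e12] R_refl unfolding origami_def by blast
    then show "(ov e1, ov e2) \<in> link VG (- {e1})"
      using component_of_del_arc_eq_iff R_arcs[OF e12] by blast
  next
    show "s (s y) = y" for y by (rule H.arev_arev)
    show "fE (r e) = s (fE e)" if "e \<in> arcs D" for e
      using f that by (simp add: serre_morphism_def)
  next
    fix e1 e2 assume "(e1, e2) \<in> same_edge"
    then show "fE e1 = fE e2"
      using g(3) quotient_edge_map_eq_iff same_edge_arcs same_edge_sym
      by (cases "e1 \<in> arcs D") (metis, metis same_edge_no_arc)
  next
    fix e1 e2 assume e: "e1 \<in> arcs D" "e2 \<in> arcs D" "(ov e1, ov e2) \<in> link VG UNIV"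
      and eq: "fE e1 = fE e2"
    have "qV (tail D e1) = qV (tail D e2)"
      using e quotient_vertex_map_eq_iff by simp
    then have "qE e1 \<in> out_arcs (quotient_graph D r R) (qV (tail D e1))"
        "qE e2 \<in> out_arcs (quotient_graph D r R) (qV (tail D e1))"
      using e quotient_tail_qE[OF gc] components_EG by (auto simp: out_arcs_def quotient_graph_def)
    moreover have "qV (tail D e1) \<in> verts (quotient_graph D r R)"
      using e components_VG by (simp add: quotient_graph_def)
    moreover have "gE (qE e1) = gE (qE e2)" using eq g(3) e by simp
    ultimately have "qE e1 = qE e2"
      using g(1) unfolding serre_immersion_def by (meson inj_onD)
    then show "(e1, e2) \<in> same_edge" using quotient_edge_map_eq_iff e by blast
  qed
  show ?thesis by (rule null_loop_trivial[OF p])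
qed


section \<open>From injectivity to essential origamis\<close>

lemma link_image:
  assumes "\<And>e. e \<in> arcs G \<Longrightarrow> e \<in> arcs G' \<and> tail G' e = h (tail G e) \<and> head G' e = h (head G e)"
    and "(u, v) \<in> link G A"
  shows "(h u, h v) \<in> link G' A"
  using assms(2)
proof (induction rule: link_induct)
  case (forward e)
  then have "(h (tail G e), h (head G e)) \<in> link G' A"
    using assms(1) link_arc[of e G' A] by simp
  then show ?case by (rule link_trans[OF forward(4)])
next
  case (backward e)
  then have "(h (head G e), h (tail G e)) \<in> link G' A"
    using assms(1) link_arc'[of e G' A] by simp
  then show ?case by (rule link_trans[OF backward(4)])
qed simp

lemma link_collapse:
  assumes wf: "wf_digraph G"
    and hom: "\<And>e. e \<in> arcs G' \<Longrightarrow> e \<in> arcs G \<and> tail G' e = h (tail G e) \<and> head G' e = h (head G e)"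
    and fibre: "\<And>x y. \<lbrakk>x \<in> verts G; y \<in> verts G; h x = h y\<rbrakk> \<Longrightarrow>
      x = y \<or> (x = c1 \<and> y = c2) \<or> (x = c2 \<and> y = c1)"
    and uv: "u \<in> verts G" "v \<in> verts G" "(h u, h v) \<in> link G' A"
  shows "(u, v) \<in> link G A \<or> ((u, c1) \<in> link G A \<and> (c2, v) \<in> link G A) \<or>
    ((u, c2) \<in> link G A \<and> (c1, v) \<in> link G A)"
proof -
  define K where "K y \<longleftrightarrow> (u, y) \<in> link G A \<or> ((u, c1) \<in> link G A \<and> (c2, y) \<in> link G A) \<or>
    ((u, c2) \<in> link G A \<and> (c1, y) \<in> link G A)" for y
  have K_link: "K z" if "K y" "(y, z) \<in> link G A" for y z
    using that(1) link_trans[OF _ that(2)] unfolding K_def by blast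
  have K_fibre: "K z" if "K y" "y \<in> verts G" "z \<in> verts G" "h y = h z" for y z
    using fibre[OF that(2-4)]
  proof (elim disjE conjE)
    assume "y = c1" "z = c2"
    then show "K z" using \<open>K y\<close> link_trans[of u c2 G A c1] link_sym unfolding K_def
      by (metis link_refl link_trans)
  next
    assume "y = c2" "z = c1"
    then show "K z" using \<open>K y\<close> unfolding K_def
      by (metis link_refl link_trans)
  qed (use \<open>K y\<close> in simp)
  have "\<exists>y\<in>verts G. h y = h v \<and> K y"
    using uv(3)
  proof (induction rule: link_induct)
    case refl
    then show ?case using uv(1) by (auto simp: K_def)
  next
    case (forward e)
    then obtain y where y: "y \<in> verts G" "h y = tail G' e" "K y" by blast
    have e: "e \<in> arcs G" "tail G' e = h (tail G e)" "head G' e = h (head G e)"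
      using hom forward(1) by auto
    then have "K (tail G e)" using K_fibre[OF y(3,1)] y(2) wf by (simp add: wf_digraph_def)
    then have "K (head G e)" using K_link link_arc[OF e(1) forward(2)] by blast
    then show ?case using e wf by (auto simp: wf_digraph_def)
  next
    case (backward e)
    then obtain y where y: "y \<in> verts G" "h y = head G' e" "K y" by blast
    have e: "e \<in> arcs G" "tail G' e = h (tail G e)" "head G' e = h (head G e)"
      using hom backward(1) by auto
    then have "K (head G e)" using K_fibre[OF y(3,1)] y(2) wf by (simp add: wf_digraph_def)
    then have "K (tail G e)" using K_link link_arc'[OF e(1) backward(2)] by blast
    then show ?case using e wf by (auto simp: wf_digraph_def)
  qed
  then show ?thesis using K_fibre uv(2) unfolding K_def by blast
qed

context open_relation
begin

text \<open>Balanced words map to null-homotopic words in the quotient graph.\<close>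

inductive balanced :: "'b list \<Rightarrow> bool" where
  Nil: "balanced []"
| pair: "balanced p \<Longrightarrow> balanced q \<Longrightarrow> (r a, b) \<in> same_edge \<Longrightarrow> balanced (a # p @ b # q)"

lemma balanced_append: "balanced p \<Longrightarrow> balanced q \<Longrightarrow> balanced (p @ q)"
proof (induction rule: balanced.induct)
  case (pair p q' a b)
  then show ?case using balanced.pair[of p "q' @ q" a b] by simp
qed simp

text \<open>Stated for any letter map that respects inversion and components of the edge graph,
  because it is applied both to \<open>f\<close> and to the map sending an edge to its
  component.\<close>

lemma free_red_balanced:
  assumes "balanced p" "set p \<subseteq> arcs D"
    and inv: "\<And>y. t (t y) = y"
    and g: "\<And>a. a \<in> arcs D \<Longrightarrow> g (r a) = t (g a)"
      "\<And>a b. a \<in> arcs D \<Longrightarrow> (a, b) \<in> same_edge \<Longrightarrow> g a = g b"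
  shows "free_red t (map g p) = []"
  using assms(1,2)
proof (induction rule: balanced.induct)
  case (pair p q a b)
  then have "g b = t (g a)" using g(1)[of a] g(2)[of "r a" b] by (simp add: arev_in_arcs_iff)
  then show ?case
    using free_red_cancel_inner[of t "map g p" "[]" "g a" "map g q", OF inv] pair by simp
qed simp

end

text \<open>Plain local consistency would not do: a relation maximal with that property can get stuck
  before the quotient immerses. Avoiding all edges with the letter of the class guarantees that
  some pair of classes can still be merged. The walks in the last assumption exclude
  identifications of vertices that are not forced by folding.\<close>

locale folding = open_relation D r R
  for D :: "('a, 'b) pre_digraph" and r :: "'b \<Rightarrow> 'b" and R :: "'b rel" +
  fixes f :: "'b \<Rightarrow> 'd"
  assumes f_R: "(a, b) \<in> R \<Longrightarrow> f a = f b"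
    and letter_consistency: "(a, b) \<in> R \<Longrightarrow> (ov a, ov b) \<in> link VG {d. f d \<noteq> f a}"
    and bridge: "e \<in> arcs D \<Longrightarrow> (ov e, cv e) \<notin> link VG (- {e})"
    and linked_balanced: "\<lbrakk>u \<in> verts D; (Vertex u, Vertex v) \<in> link VG UNIV\<rbrakk>
      \<Longrightarrow> \<exists>p. awalk u p v \<and> balanced p"

text \<open>The involution on letters. Edges in one component of the edge graph share their letter,
  so \<open>s_free\<close> is the source of non-singularity.\<close>

locale folding_map = folding D r R f
  for D :: "('a, 'b) pre_digraph" and r :: "'b \<Rightarrow> 'b" and R :: "'b rel"
    and f :: "'b \<Rightarrow> 'd" +
  fixes s :: "'d \<Rightarrow> 'd"
  assumes s_inv: "s (s y) = y"
    and s_free: "e \<in> arcs D \<Longrightarrow> s (f e) \<noteq> f e"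
    and f_arev: "e \<in> arcs D \<Longrightarrow> f (r e) = s (f e)"
begin

lemma f_CR:
  assumes "(a, b) \<in> CR"
  shows "f a = f b"
proof -
  have ab: "a \<in> arcs D" "b \<in> arcs D" "(r a, r b) \<in> R" using assms by (auto simp: CR_iff)
  then have "s (f a) = s (f b)" using f_R[OF ab(3)] f_arev by simp
  then show ?thesis using s_inv by metis
qed

lemma f_same_edge: "(a, b) \<in> same_edge \<Longrightarrow> f a = f b"
  unfolding same_edge_def by (induction rule: rtrancl_induct) (auto dest: f_CR f_R)

text \<open>A path in the edge graph from the closed to the open class of \<open>e\<close> that
  avoids \<open>e\<close> is followed in the vertex graph. All its edges carry the letter of
  \<open>e\<close>; an open class is crossed by letter consistency along edges with other letters,
  so \<open>e\<close> is avoided there as well, against \<open>bridge\<close>.\<close>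

lemma bridge_EG:
  assumes e: "e \<in> arcs D"
  shows "(tail EG e, head EG e) \<notin> link EG (- {e})"
proof
  define P where "P x = (case x of
      Open_Class X \<Rightarrow> \<forall>d\<in>X. f d = f e \<and> (cv e, ov d) \<in> link VG (- {e})
    | Closed_Class X \<Rightarrow> \<forall>d\<in>X. f d = f e \<and> (cv e, cv d) \<in> link VG (- {e}))" for x
  assume "(tail EG e, head EG e) \<in> link EG (- {e})"
  then have "(head EG e, tail EG e) \<in> link EG (- {e})" by (rule link_sym)
  then have "P (tail EG e)"
  proof (induction rule: link_induct)
    case refl
    have "cv d = cv e" if "(e, d) \<in> CR" for d using that e CR_class_eq_iff R_sym by (auto simp: CR_iff)
    then show ?case using f_CR by (auto simp: P_def)
  next
    case (forward d)
    then have d: "d \<in> arcs D" "d \<noteq> e" "f d = f e" "(cv e, ov d) \<in> link VG (- {e})"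
      using R_refl by (auto simp: P_def)
    then have "(cv e, cv d) \<in> link VG (- {e})"
      using link_trans[OF d(4) link_VG(1)] by simp
    moreover have "cv c = cv d" if "(d, c) \<in> CR" for c
      using that CR_class_eq_iff R_sym by (auto simp: CR_iff)
    ultimately show ?case using f_CR d by (auto simp: P_def)
  next
    case (backward d)
    then have d: "d \<in> arcs D" "d \<noteq> e" "f d = f e" "(cv e, cv d) \<in> link VG (- {e})"
      using CR_refl by (auto simp: P_def)
    then have *: "(cv e, ov d) \<in> link VG (- {e})"
      using link_trans[OF d(4) link_VG(2)] by simp
    have "(cv e, ov c) \<in> link VG (- {e})" if c: "(d, c) \<in> R" for c
    proof -
      have "{d'. f d' \<noteq> f d} \<subseteq> - {e}" using d(3) by auto
      then show ?thesis using link_trans[OF *] link_mono letter_consistency[OF c] by metis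
    qed
    then show ?case using f_R d by (auto simp: P_def)
  qed
  then have "(cv e, ov e) \<in> link VG (- {e})" using R_refl[OF e] by (auto simp: P_def)
  then show False using bridge[OF e] link_sym by metis
qed

end

text \<open>The data of one fold. The path in \<open>linked\<close> avoids the common letter, as
  letter consistency will require once the classes of \<open>e1\<close> and \<open>e2\<close> are
  merged.\<close>

locale folding_step = folding_map +
  fixes e1 e2
  assumes arcs: "e1 \<in> arcs D" "e2 \<in> arcs D"
    and f_eq: "f e1 = f e2"
    and linked: "(ov e1, ov e2) \<in> link VG {d. f d \<noteq> f e1}"
    and not_same: "(e1, e2) \<notin> same_edge"
    and trivial_kernel: "\<And>x p. awalk x p x \<Longrightarrow> free_red s (map f p) = [] \<Longrightarrow> free_red r p = []"
begin

definition merged :: "'b rel" where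
  "merged = R \<union> R `` {e1} \<times> R `` {e2} \<union> R `` {e2} \<times> R `` {e1}"

lemma merged_iff: "(a, b) \<in> merged \<longleftrightarrow> (a, b) \<in> R \<or> ((e1, a) \<in> R \<and> (e2, b) \<in> R) \<or>
    ((e2, a) \<in> R \<and> (e1, b) \<in> R)"
  by (auto simp: merged_def)

lemma equiv_merged: "equiv (arcs D) merged"
proof -
  have "(e1, e2) \<notin> R" using not_same same_edge_R by blast
  then have "\<not> ((e1, a) \<in> R \<and> (e2, a) \<in> R)" for a using R_sym R_trans by blast
  then have "trans merged" unfolding trans_def merged_iff by (meson R_sym R_trans)
  moreover have "sym merged" unfolding sym_def merged_iff using R_sym by blast
  moreover have "refl_on (arcs D) merged"
    unfolding refl_on_def merged_iff using R_refl by blast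
  moreover have "merged \<subseteq> arcs D \<times> arcs D" using merged_iff R_arcs by auto
  ultimately show ?thesis by (simp add: equiv_def)
qed

sublocale N: open_relation D r merged
  by unfold_locales (rule equiv_merged)

text \<open>Identifying the ends of the two folded edges would produce a loop \<open>e1 \<cdots> e2\<^sup>* \<cdots>\<close> in the kernel
  whose image in the quotient graph reduces to the two letters \<open>e1 e2\<^sup>*\<close>, which do not cancel.\<close>

lemma closed_ends_not_linked: "(cv (r e1), cv (r e2)) \<notin> link VG UNIV"
proof
  have re: "r e1 \<in> arcs D" "r e2 \<in> arcs D" using arcs by (auto simp: arev_in_arcs_iff)
  assume "(cv (r e1), cv (r e2)) \<in> link VG UNIV"
  then have "(ov (r e1), ov (r e2)) \<in> link VG UNIV"
    using link_VG[OF re(1), of UNIV] link_VG[OF re(2), of UNIV] link_trans by (metis UNIV_I)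
  then have "(Vertex (head D e1), Vertex (head D e2)) \<in> link VG UNIV" using arcs by simp
  then obtain p where p: "awalk (head D e1) p (head D e2)" "balanced p"
    using linked_balanced[OF head_in_verts[OF arcs(1)]] by blast
  have "(ov e2, ov e1) \<in> link VG UNIV" using link_sym[OF link_mono[OF subset_UNIV linked]] .
  then obtain q where q: "awalk (tail D e2) q (tail D e1)" "balanced q"
    using linked_balanced[OF tail_in_verts[OF arcs(2)]] by blast
  define c where "c = e1 # p @ r e2 # q"
  have "awalk (head D e2) (r e2 # q) (tail D e1)"
    using q re arcs by (simp add: awalk_Cons_iff head_arev)
  then have c: "awalk (tail D e1) c (tail D e1)"
    unfolding c_def using p(1) arcs by (simp add: awalk_Cons_iff awalk_appendI)
  have sub: "set p \<subseteq> arcs D" "set q \<subseteq> arcs D" using p q by (auto simp: awalk_def)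
  have null_f: "free_red s (map f p) = []" "free_red s (map f q) = []"
    using free_red_balanced[of _ s f, OF _ _ s_inv f_arev f_same_edge] p q sub by auto
  have "f (r e2) = s (f e1)" using f_arev arcs f_eq by simp
  then have "free_red s (map f c) = []"
    using free_red_cancel_inner[of s "map f p" "[]" "f e1" "map f q", OF s_inv null_f(1)] null_f(2)
    by (simp add: c_def)
  then have null: "free_red r c = []" using trivial_kernel[OF c] by blast
  \<comment> \<open>The letters of the quotient graph: components of the edge graph as sets of
    edges, inverted by taking images under \<open>r\<close>.\<close>
  define g where "g a = same_edge `` {a}" for a
  have inv: "r ` (r ` X) = X" for X by (simp add: image_image arev_arev)
  have g_r: "g (r a) = r ` g a" for a
  proof (intro equalityI subsetI)
    fix x assume "x \<in> g (r a)"
    then have "r x \<in> g a" using same_edge_arev[of "r a" x] by (simp add: g_def arev_arev)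
    then show "x \<in> r ` g a" using arev_arev[of x] by force
  qed (auto simp: g_def intro: same_edge_arev)
  have g_eq: "g a = g b \<longleftrightarrow> (a, b) \<in> same_edge" for a b
  proof
    assume "g a = g b"
    then have "b \<in> g a" by (simp add: g_def)
    then show "(a, b) \<in> same_edge" by (simp add: g_def)
  qed (use same_edge_sym same_edge_trans in \<open>unfold g_def, blast\<close>)
  have null_g: "free_red (image r) (map g p) = []" "free_red (image r) (map g q) = []"
    using free_red_balanced[of _ "image r" g, OF _ _ inv g_r] p q sub g_eq by auto
  have "free_red (image r) (map g c) = []"
    using free_red_map[of "image r" c g r, OF inv g_r] null by simp
  \<comment> \<open>The same word computed directly: the balanced parts vanish and two letters
    remain.\<close>
  moreover have "free_red (image r) (map g c) = free_red (image r) [g e1, g (r e2)]"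
  proof -
    have "free_red (image r) (map g p @ (g (r e2) # map g q)) = free_red (image r) ([] @ [g (r e2)])"
      using null_g by (intro free_red_append_cong inv) (simp_all add: free_red_Cons)
    then show ?thesis by (simp add: c_def free_red_Cons)
  qed
  ultimately have "g (r e2) = r ` g e1"
    by (simp add: free_red_Cons cancel_def split: if_splits)
  then have "(r e2, r e1) \<in> same_edge" by (simp only: g_r[symmetric] g_eq)
  then have "(e2, e1) \<in> same_edge" using same_edge_arev[of "r e2" "r e1"] by (simp add: arev_arev)
  then show False using not_same same_edge_sym by blast
qed

section \<open>The vertex graph after merging two open classes\<close>

lemma CR_subset: "CR \<subseteq> N.CR"
  by (auto simp: closed_rel_def merged_iff)

text \<open>The closed relation is the open one conjugated by \<open>r\<close>, so merging the open
  classes of \<open>e1\<close> and \<open>e2\<close> merges the closed classes of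
  \<open>r e1\<close> and \<open>r e2\<close> and no others.\<close>

lemma N_CR_cases:
  assumes "(a, b) \<in> N.CR"
  shows "cv a = cv b \<or> (cv a = cv (r e1) \<and> cv b = cv (r e2)) \<or>
    (cv a = cv (r e2) \<and> cv b = cv (r e1))"
proof -
  have ab: "a \<in> arcs D" "b \<in> arcs D" and m: "(r a, r b) \<in> merged"
    using assms by (auto simp: N.CR_iff)
  have eq: "cv x = cv (r e)" if "x \<in> arcs D" "e \<in> arcs D" "(e, r x) \<in> R" for x e
  proof -
    have "(r e, x) \<in> CR" using that by (simp add: CR_iff arev_arev arev_in_arcs_iff)
    then have "CR `` {r e} = CR `` {x}"
      using CR_class_eq_iff that by (metis arev_in_arcs_iff)
    then show ?thesis by simp
  qed
  from m show ?thesis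
    unfolding merged_iff
  proof (elim disjE conjE)
    assume "(r a, r b) \<in> R"
    then have "(a, b) \<in> CR" using ab by (simp add: CR_iff)
    then have "CR `` {a} = CR `` {b}" using CR_class_eq_iff ab by blast
    then show ?thesis by simp
  next
    assume "(e1, r a) \<in> R" "(e2, r b) \<in> R"
    then show ?thesis using eq ab arcs by blast
  next
    assume "(e2, r a) \<in> R" "(e1, r b) \<in> R"
    then show ?thesis using eq ab arcs by blast
  qed
qed

definition collapse :: "('a, 'b) vertex_vertex \<Rightarrow> ('a, 'b) vertex_vertex" where
  "collapse x = (case x of Vertex v \<Rightarrow> Vertex v | VClosed_Class X \<Rightarrow> VClosed_Class (N.CR `` X))"

lemma collapse_Vertex [simp]: "collapse (Vertex v) = Vertex v"
  by (simp add: collapse_def)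

lemma collapse_cv:
  assumes "e \<in> arcs D"
  shows "collapse (cv e) = N.cv e"
proof -
  have "N.CR `` (CR `` {e}) = N.CR `` {e}"
    using CR_subset CR_refl[OF assms] N.CR_trans by blast
  then show ?thesis by (simp add: collapse_def)
qed

lemma collapse_hom: "e \<in> arcs D \<Longrightarrow>
    tail N.VG e = collapse (tail VG e) \<and> head N.VG e = collapse (head VG e)"
  by (simp add: collapse_cv)

lemma link_N: "(x, y) \<in> link VG A \<Longrightarrow> (collapse x, collapse y) \<in> link N.VG A"
  by (rule link_image) (use collapse_hom in auto)

lemma link_N_cases:
  assumes "(collapse x, collapse y) \<in> link N.VG A" "x \<in> verts VG" "y \<in> verts VG"
  shows "(x, y) \<in> link VG A \<or> ((x, cv (r e1)) \<in> link VG A \<and> (cv (r e2), y) \<in> link VG A) \<or>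
    ((x, cv (r e2)) \<in> link VG A \<and> (cv (r e1), y) \<in> link VG A)"
proof (rule link_collapse[OF wf_VG _ _ assms(2,3,1)])
  fix x y assume x: "x \<in> verts VG" and y: "y \<in> verts VG" and eq: "collapse x = collapse y"
  consider v where "x = Vertex v" | a where "a \<in> arcs D" "x = cv a"
    using x unfolding verts_VG by blast
  then show "x = y \<or> (x = cv (r e1) \<and> y = cv (r e2)) \<or> (x = cv (r e2) \<and> y = cv (r e1))"
  proof cases
    case 1
    then show ?thesis using eq y by (auto simp: verts_VG collapse_cv)
  next
    case (2 a)
    then obtain b where b: "b \<in> arcs D" "y = cv b"
      using eq y by (auto simp: verts_VG collapse_cv)
    then have "N.CR `` {a} = N.CR `` {b}" using eq 2 by (simp add: collapse_cv)
    then have "(a, b) \<in> N.CR" using N.CR_class_eq_iff 2 b by blast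
    then show ?thesis using N_CR_cases 2 b by blast
  qed
qed (use collapse_hom in auto)

lemma R_imp_merged: "(a, b) \<in> R \<Longrightarrow> (a, b) \<in> merged"
  by (simp add: merged_iff)

lemma same_edge_N: "(a, b) \<in> same_edge \<Longrightarrow> (a, b) \<in> N.same_edge"
  unfolding same_edge_def N.same_edge_def
  by (rule rtrancl_mono[THEN subsetD, rotated]) (use CR_subset R_imp_merged in auto)

lemma balanced_N: "balanced p \<Longrightarrow> N.balanced p"
  by (induction rule: balanced.induct) (auto intro: N.balanced.intros same_edge_N)

lemma folding_merged: "folding D r merged f"
proof unfold_locales
  fix a b assume "(a, b) \<in> merged"
  then consider "(a, b) \<in> R" | c d where "(c = e1 \<and> d = e2) \<or> (c = e2 \<and> d = e1)" "(c, a) \<in> R" "(d, b) \<in> R"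
    unfolding merged_iff by blast
  note cases = this
  show fab: "f a = f b"
    using cases f_R f_eq by cases metis+
  have "(ov a, ov b) \<in> link VG {d. f d \<noteq> f a}"
    using cases
  proof cases
    case 1
    then show ?thesis by (rule letter_consistency)
  next
    case (2 c d)
    then have fc: "f c = f a" "f d = f a" "f e1 = f a" using f_R f_eq fab by metis+
    have "(ov a, ov c) \<in> link VG {d. f d \<noteq> f a}"
      using link_sym[OF letter_consistency[OF 2(2)]] fc by simp
    moreover have "(ov c, ov d) \<in> link VG {d. f d \<noteq> f a}"
      using 2(1) linked link_sym[OF linked] fc by auto
    moreover have "(ov d, ov b) \<in> link VG {d. f d \<noteq> f a}"
      using letter_consistency[OF 2(3)] fc by simp
    ultimately show ?thesis using link_trans by metis
  qed
  from link_N[OF this] show "(ov a, ov b) \<in> link N.VG {d. f d \<noteq> f a}" by simp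
next
  fix e assume e: "e \<in> arcs D"
  show "(ov e, N.cv e) \<notin> link N.VG (- {e})"
  proof
    assume "(ov e, N.cv e) \<in> link N.VG (- {e})"
    then have "(collapse (ov e), collapse (cv e)) \<in> link N.VG (- {e})"
      using collapse_cv[OF e] by simp
    from link_N_cases[OF this] consider "(ov e, cv e) \<in> link VG (- {e})"
      | c d where "(c = e1 \<and> d = e2) \<or> (c = e2 \<and> d = e1)"
          "(ov e, cv (r c)) \<in> link VG (- {e})" "(cv (r d), cv e) \<in> link VG (- {e})"
      using e by (auto simp: verts_VG)
    then show False
    proof cases
      case 1
      then show ?thesis using bridge[OF e] by blast
    next
      case (2 c d)
      \<comment> \<open>A cycle created by the merge passes through the new vertex. Putting
        \<open>e\<close> back joins its two pieces to an old path between the closed vertices of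
        \<open>r e1\<close> and \<open>r e2\<close>.\<close>
      have "(cv (r c), ov e) \<in> link VG UNIV" "(cv e, cv (r d)) \<in> link VG UNIV"
        using link_mono[OF subset_UNIV] link_sym 2 by metis+
      then have "(cv (r c), cv (r d)) \<in> link VG UNIV"
        using link_VG(1)[OF e UNIV_I] link_trans by metis
      then show False using closed_ends_not_linked link_sym 2(1) by metis
    qed
  qed
next
  fix u v assume u: "u \<in> verts D" and uv: "(Vertex u, Vertex v) \<in> link N.VG UNIV"
  have v: "v \<in> verts D"
  proof -
    have "Vertex v \<in> verts N.VG"
      using uv
    proof (induction rule: link_induct)
      case refl
      then show ?case using u by (simp add: N.verts_VG)
    qed (use N.wf_VG in \<open>auto simp: wf_digraph_def\<close>)
    then show ?thesis by (auto simp: N.verts_VG)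
  qed
  have "(collapse (Vertex u), collapse (Vertex v)) \<in> link N.VG UNIV" using uv by simp
  from link_N_cases[OF this] consider "(Vertex u, Vertex v) \<in> link VG UNIV"
    | c d where "(c = e1 \<and> d = e2) \<or> (c = e2 \<and> d = e1)"
        "(Vertex u, cv (r c)) \<in> link VG UNIV" "(cv (r d), Vertex v) \<in> link VG UNIV"
    using u v by (auto simp: verts_VG)
  then show "\<exists>p. awalk u p v \<and> N.balanced p"
  proof cases
    case 1
    then show ?thesis using linked_balanced[OF u] balanced_N by blast
  next
    case (2 c d)
    then have cd: "c \<in> arcs D" "d \<in> arcs D" "r c \<in> arcs D" "r d \<in> arcs D"
      using arcs by (auto simp: arev_in_arcs_iff)
    have "(Vertex u, ov (r c)) \<in> link VG UNIV"
      using link_trans[OF 2(2) link_VG(2)[OF cd(3)]] by simp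
    then obtain p1 where p1: "awalk u p1 (head D c)" "balanced p1"
      using linked_balanced[OF u] cd by auto
    have "(ov (r d), Vertex v) \<in> link VG UNIV"
      using link_trans[OF link_VG(1)[OF cd(4)] 2(3)] by simp
    then obtain p2 where p2: "awalk (head D d) p2 v" "balanced p2"
      using linked_balanced[of "head D d"] cd by auto
    have "(ov c, ov d) \<in> link VG UNIV"
      using 2(1) link_mono[OF subset_UNIV linked] link_sym by metis
    then obtain p where p: "awalk (tail D c) p (tail D d)" "balanced p"
      using linked_balanced[of "tail D c"] cd by auto
    \<comment> \<open>Passing the new vertex is realised in \<open>D\<close> by going back along
      \<open>c\<close>, following \<open>p\<close> and going out along \<open>d\<close>. This is
      balanced because \<open>c\<close> and \<open>d\<close> have become equivalent.\<close>
    have "awalk (tail D d) (d # p2) v" using p2 cd by (simp add: awalk_Cons_iff)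
    then have "awalk (tail D c) (p @ d # p2) v" using p(1) awalk_appendI by blast
    then have "awalk (head D c) (r c # p @ d # p2) v"
      unfolding awalk_Cons_iff[of _ "r c"] using cd by (simp only: tail_arev head_arev simp_thms)
    then have "awalk u (p1 @ r c # p @ d # p2) v" using p1(1) awalk_appendI by blast
    moreover have "(c, d) \<in> merged" using 2(1) R_refl arcs by (auto simp: merged_iff)
    then have "N.balanced (r c # p @ d # p2)"
      using N.balanced.pair[of p p2 "r c" d] p p2 balanced_N N.same_edge_R by (simp add: arev_arev)
    then have "N.balanced (p1 @ r c # p @ d # p2)"
      using N.balanced_append balanced_N p1(2) by blast
    ultimately show ?thesis by blast
  qed
qed

lemma merged_larger: "R \<subset> merged"
proof -
  have "(e1, e2) \<in> merged" using R_refl arcs by (auto simp: merged_iff)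
  moreover have "(e1, e2) \<notin> R" using not_same same_edge_R by blast
  ultimately show ?thesis using R_imp_merged by auto
qed

end


section \<open>Maximal relations: from letter-avoiding paths to arbitrary ones\<close>

locale maximal_folding = folding_map +
  assumes trivial_kernel: "\<And>x p. awalk x p x \<Longrightarrow> free_red s (map f p) = [] \<Longrightarrow> free_red r p = []"
    and maximal: "\<And>R'. folding D r R' f \<Longrightarrow> \<not> R \<subset> R'"
begin

lemma same_edge_if_linked_avoiding_letter:
  assumes "e1 \<in> arcs D" "e2 \<in> arcs D" "f e1 = f e2"
    and "(ov e1, ov e2) \<in> link VG {d. f d \<noteq> f e1}"
  shows "(e1, e2) \<in> same_edge"
proof (rule ccontr)
  assume "(e1, e2) \<notin> same_edge"
  then interpret folding_step D r R f s e1 e2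
    using assms trivial_kernel by unfold_locales auto
  show False using maximal[OF folding_merged] merged_larger by blast
qed

text \<open>Along the path in \<open>VG\<close>, every passage through a closed class of edges with letter \<open>f e1\<close>
  is preceded by a segment avoiding that letter, to which the previous lemma applies.\<close>

lemma same_edge_if_linked:
  assumes e: "e1 \<in> arcs D" "e2 \<in> arcs D" "f e1 = f e2"
    and "(ov e1, ov e2) \<in> link VG UNIV"
  shows "(e1, e2) \<in> same_edge"
proof -
  let ?A = "{d. f d \<noteq> f e1}"
  \<comment> \<open>An edge \<open>d\<close> known to be in the component of \<open>e1\<close> and
    carrying its letter serves as a new starting point for a letter-avoiding path.\<close>
  define near where "near x \<longleftrightarrow>
    (\<exists>d\<in>arcs D. f d = f e1 \<and> (e1, d) \<in> same_edge \<and> (ov d, x) \<in> link VG ?A)" for x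
  have near_same: "(e1, d) \<in> same_edge" if d: "d \<in> arcs D" "f d = f e1" "near (ov d)" for d
  proof -
    obtain c where c: "c \<in> arcs D" "f c = f e1" "(e1, c) \<in> same_edge" "(ov c, ov d) \<in> link VG ?A"
      using d(3) unfolding near_def by blast
    then have "(c, d) \<in> same_edge"
      using same_edge_if_linked_avoiding_letter[of c d] d by simp
    with c(3) show ?thesis by (rule same_edge_trans)
  qed
  have near_link: "near y" if "near x" "(x, y) \<in> link VG ?A" for x y
    using that(1) link_trans[OF _ that(2)] unfolding near_def by blast
  \<comment> \<open>A closed class consists of edges with one letter. If this is the letter of
    \<open>e1\<close>, the class may have been entered along a forbidden edge, so its members
    themselves are recorded as being in the component of \<open>e1\<close>.\<close>
  define P where "P x = (case x of Vertex v \<Rightarrow> near (Vertex v)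
    | VClosed_Class X \<Rightarrow> \<forall>d\<in>X. if f d = f e1 then (e1, d) \<in> same_edge else near (VClosed_Class X))" for x
  from assms(4) have "P (ov e2)"
  proof (induction rule: link_induct)
    case refl
    then show ?case using e(1) by (auto simp: P_def near_def)
  next
    case (forward d)
    then have d: "d \<in> arcs D" "near (ov d)" by (simp_all add: P_def)
    show ?case
    proof (cases "f d = f e1")
      case True
      then have "(e1, d) \<in> same_edge" using near_same d by blast
      then have "(e1, c) \<in> same_edge \<and> f c = f e1" if "(d, c) \<in> CR" for c
        using same_edge_trans[OF _ same_edge_CR[OF that]] f_CR[OF that] True by simp
      then show ?thesis by (auto simp: P_def)
    next
      case False
      then have "near (cv d)" using near_link[OF d(2)] link_VG(1)[OF d(1)] by simp
      moreover have "f c \<noteq> f e1" if "(d, c) \<in> CR" for c using f_CR[OF that] False by simp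
      ultimately show ?thesis by (auto simp: P_def)
    qed
  next
    case (backward d)
    have d: "d \<in> arcs D" using backward by simp
    then have "d \<in> CR `` {d}" using CR_refl by simp
    with backward(4) have d': "if f d = f e1 then (e1, d) \<in> same_edge else near (cv d)"
      by (simp add: P_def)
    have "near (ov d)"
    proof (cases "f d = f e1")
      case True
      then show ?thesis using d d' unfolding near_def by (intro bexI[of _ d]) auto
    next
      case False
      then show ?thesis using near_link[OF _ link_VG(2)[OF d]] d' by simp
    qed
    then show ?case by (simp add: P_def)
  qed
  then show ?thesis using near_same e by (simp add: P_def)
qed

end

text \<open>For the discrete relation the closed classes are singletons, so the vertex graph is a
  disjoint union of stars centred at the vertices of \<open>D\<close>, and the empty walk joins
  linked vertices.\<close>

lemma folding_Id_on:
  assumes "bidirected_digraph D r"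
  shows "folding D r (Id_on (arcs D)) f"
proof -
  interpret bidirected_digraph D r by fact
  interpret open_relation D r "Id_on (arcs D)"
    by unfold_locales (auto simp: equiv_def refl_on_def sym_def trans_def)
  have CR: "CR = Id_on (arcs D)"
    using arev_arev by (auto simp: CR_iff Id_on_iff arev_in_arcs_iff) (metis arev_arev)+
  have cv_eq: "a = b" if "cv a = cv b" "a \<in> arcs D" for a b
    using that by (auto simp: CR)
  show ?thesis
  proof unfold_locales
    fix e assume e: "e \<in> arcs D"
    show "(ov e, cv e) \<notin> link VG (- {e})"
    proof
      assume "(ov e, cv e) \<in> link VG (- {e})"
      then have "(cv e, ov e) \<in> link VG (- {e})" by (rule link_sym)
      then have "ov e = cv e"
      proof (induction rule: link_induct)
        case (backward d)
        then have "cv d = cv e" by simp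
        then show ?case using cv_eq backward by fastforce
      qed auto
      then show False by simp
    qed
  next
    fix u v assume u: "u \<in> verts D" and uv: "(Vertex u, Vertex v) \<in> link VG UNIV"
    define P where "P x \<longleftrightarrow> x = Vertex u \<or> (\<exists>e\<in>arcs D. tail D e = u \<and> x = cv e)" for x
    from uv have "P (Vertex v)"
    proof (induction rule: link_induct)
      case (backward d)
      then obtain e where "e \<in> arcs D" "tail D e = u" "cv d = cv e" by (auto simp: P_def)
      then show ?case using cv_eq[of e d] by (simp add: P_def)
    qed (auto simp: P_def)
    then have "v = u" by (simp add: P_def)
    then have "awalk u [] v" using u by (auto simp: awalk_Nil_iff)
    then show "\<exists>p. awalk u p v \<and> balanced p" using balanced.Nil by blast
  qed auto
qed

section \<open>The origami of a maximal relation and its immersed quotient\<close>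

lemma trivial_kernel_imp_essential_origami_compatible:
  assumes D: "bidirected_digraph D r" and fin: "finite (arcs D)" and H: "bidirected_digraph H s"
    and f: "serre_morphism D r H s fV fE"
    and trivial_kernel:
      "\<And>x p. pre_digraph.awalk D x p x \<Longrightarrow> free_red s (map fE p) = [] \<Longrightarrow> free_red r p = []"
  shows "\<exists>R. essential_origami D r R \<and> origami_compatible D r H s fV fE R"
proof -
  interpret D: bidirected_digraph D r by fact
  interpret H: bidirected_digraph H s by fact
  have f_arc: "fE e \<in> arcs H" "tail H (fE e) = fV (tail D e)" "head H (fE e) = fV (head D e)"
      "fE (r e) = s (fE e)" if "e \<in> arcs D" for e
    using f that by (auto simp: serre_morphism_def)
  have "{R. folding D r R fE} \<subseteq> Pow (arcs D \<times> arcs D)"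
    using open_relation.R_arcs unfolding folding_def by fast
  then have "finite {R. folding D r R fE}" using fin finite_subset by blast
  then obtain R where R: "folding D r R fE" "\<And>R'. folding D r R' fE \<Longrightarrow> \<not> R \<subset> R'"
    using finite_has_maximal[of "{R. folding D r R fE}"] folding_Id_on[OF D, of fE] by blast
  interpret folding D r R fE by fact
  interpret maximal_folding D r R fE s
  proof unfold_locales
    show "s (fE e) \<noteq> fE e" if "e \<in> arcs D" for e using f_arc that H.arev_dom by blast
  qed (use H.arev_arev f_arc trivial_kernel R in auto)
  have link_UNIV: "(ov a, ov b) \<in> link VG UNIV" if "(a, b) \<in> R" for a b
    using link_mono[OF subset_UNIV letter_consistency[OF that]] .
  have "origami D r R"
    unfolding origami_def
  proof (intro conjI ballI, goal_cases)
    case 1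
    show ?case by (rule equiv)
  next
    case (2 e)
    then have "(e, r e) \<notin> same_edge" using f_same_edge[of e "r e"] f_arev[OF 2] s_free[OF 2] by metis
    then show ?case using quotient_edge_map_eq_iff 2 by (simp add: D.arev_in_arcs_iff)
  next
    case (3 x)
    then show ?case
      using link_UNIV R_arcs component_of_eq_iff[OF wf_VG] ov_in_verts by (cases x) auto
  next
    case (4 e a b)
    then have ab: "(e, a) \<in> R" "(e, b) \<in> R" by auto
    \<comment> \<open>Deleting all edges with the letter of \<open>e\<close> deletes
      \<open>e\<close>, so letter consistency implies local consistency.\<close>
    have "{d. fE d \<noteq> fE e} \<subseteq> - {e}" by auto
    then have "(ov e, ov a) \<in> link VG (- {e})" "(ov e, ov b) \<in> link VG (- {e})"
      using link_mono letter_consistency ab by metis+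
    then have "(ov a, ov b) \<in> link VG (- {e})" using link_sym link_trans by metis
    then show ?case using component_of_del_arc_eq_iff R_arcs ab by blast
  qed
  moreover have "undirected_forest VG" "undirected_forest EG"
    using undirected_forest_iff[OF wf_VG] undirected_forest_iff[OF wf_EG] bridge bridge_EG by auto
  ultimately have essential: "essential_origami D r R" by (simp add: essential_origami_def)
  define gV where "gV X = fV (SOME v. v \<in> verts D \<and> qV v = X)" for X
  define gE where "gE C = fE (SOME e. e \<in> arcs D \<and> qE e = C)" for C
  \<comment> \<open>Members of a closed class have the same image edge, so their initial vertices
    have the same image; this makes the choice of representatives in \<open>gV\<close>
    harmless.\<close>
  have fV_linked: "fV u = fV v" if "(Vertex u, Vertex v) \<in> link VG UNIV" for u v
  proof -
    define P where "P x = (case x of Vertex w \<Rightarrow> fV w = fV u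
      | VClosed_Class X \<Rightarrow> \<forall>a\<in>X. fV (tail D a) = fV u)" for x
    from that have "P (Vertex v)"
    proof (induction rule: link_induct)
      case (forward d)
      have "fV (tail D a) = fV (tail D d)" if "(d, a) \<in> CR" for a
        using that f_CR[OF that] f_arc(2)[of a] f_arc(2)[of d] by (simp add: CR_iff)
      then show ?case using forward by (auto simp: P_def)
    next
      case (backward d)
      then show ?case using CR_refl by (auto simp: P_def)
    qed (simp add: P_def)
    then show ?thesis by (simp add: P_def)
  qed
  have gV: "gV (qV v) = fV v" if "v \<in> verts D" for v
  proof -
    have "(SOME w. w \<in> verts D \<and> qV w = qV v) \<in> verts D \<and> qV (SOME w. w \<in> verts D \<and> qV w = qV v) = qV v"
      by (rule someI[of _ v]) (use that in simp)
    then show ?thesis using fV_linked quotient_vertex_map_eq_iff that unfolding gV_def by blast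
  qed
  have gE: "gE (qE e) = fE e" if "e \<in> arcs D" for e
  proof -
    have "(SOME a. a \<in> arcs D \<and> qE a = qE e) \<in> arcs D \<and> qE (SOME a. a \<in> arcs D \<and> qE a = qE e) = qE e"
      by (rule someI[of _ e]) (use that in simp)
    then show ?thesis using f_same_edge quotient_edge_map_eq_iff that unfolding gE_def by blast
  qed
  note qt = quotient_tail_qE[OF link_UNIV]
  have "serre_morphism (quotient_graph D r R) (quotient_rev D r R) H s gV gE"
    unfolding serre_morphism_def
  proof (intro conjI ballI, goal_cases)
    case (1 X)
    then show ?case
      using f components_VG gV by (auto simp: quotient_graph_def serre_morphism_def)
  next
    case (2 C)
    then obtain e where "e \<in> arcs D" "C = qE e" using components_EG by (auto simp: quotient_graph_def)
    then show ?case using gE f_arc by simp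
  next
    case (3 C)
    then obtain e where "e \<in> arcs D" "C = qE e" using components_EG by (auto simp: quotient_graph_def)
    then show ?case using gE gV qt f_arc by (simp add: quotient_graph_def)
  next
    case (4 C)
    then obtain e where "e \<in> arcs D" "C = qE e" using components_EG by (auto simp: quotient_graph_def)
    then show ?case
      using gE gV qt f_arc by (simp add: quotient_graph_def quotient_rev_qE D.arev_in_arcs_iff)
  next
    case (5 C)
    then obtain e where "e \<in> arcs D" "C = qE e" using components_EG by (auto simp: quotient_graph_def)
    then show ?case using gE f_arc by (simp add: quotient_rev_qE D.arev_in_arcs_iff)
  qed
  moreover have "inj_on gE (out_arcs (quotient_graph D r R) X)" for X
  proof (rule inj_onI)
    fix C1 C2 assume C: "C1 \<in> out_arcs (quotient_graph D r R) X"
      "C2 \<in> out_arcs (quotient_graph D r R) X" and eq: "gE C1 = gE C2"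
    obtain e1 e2 where e: "e1 \<in> arcs D" "C1 = qE e1" "e2 \<in> arcs D" "C2 = qE e2"
      using C components_EG by (auto simp: quotient_graph_def out_arcs_def)
    have "qV (tail D e1) = qV (tail D e2)"
      using C e qt by (simp add: quotient_graph_def out_arcs_def)
    then have "(ov e1, ov e2) \<in> link VG UNIV"
      using quotient_vertex_map_eq_iff e by simp
    then show "C1 = C2"
      using same_edge_if_linked eq e gE quotient_edge_map_eq_iff by simp
  qed
  ultimately have "origami_compatible D r H s fV fE R"
    unfolding origami_compatible_def serre_immersion_def using gV gE
    by (intro exI[of _ gV] exI[of _ gE]) simp
  with essential show ?thesis by blast
qed

theorem theoremE:
  fixes \<Delta> :: "('a, 'b) pre_digraph" and r :: "'b \<Rightarrow> 'b"
    and \<Gamma> :: "('c, 'd) pre_digraph" and s :: "'d \<Rightarrow> 'd"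
    and fV :: "'a \<Rightarrow> 'c" and fE :: "'b \<Rightarrow> 'd"
  assumes "bidirected_digraph \<Delta> r" and "fin_digraph \<Delta>" and "connected \<Delta>" and "core_graph \<Delta>"
    and "bidirected_digraph \<Gamma> s" and "fin_digraph \<Gamma>" and "connected \<Gamma>" and "core_graph \<Gamma>"
    and "serre_morphism \<Delta> r \<Gamma> s fV fE"
  shows "pi1_injective \<Delta> r \<Gamma> s fV fE \<longleftrightarrow>
    (\<exists>R. essential_origami \<Delta> r R \<and> origami_compatible \<Delta> r \<Gamma> s fV fE R)"
proof -
  note iff = pi1_injective_iff[OF assms(1,5,9)]
  have "finite (arcs \<Delta>)" using assms(2) by (simp add: fin_digraph_def fin_digraph_axioms_def)
  then show ?thesis
    unfolding iff
    using trivial_kernel_imp_essential_origami_compatible[OF assms(1) _ assms(5,9)]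
      essential_origami_compatible_imp_trivial_kernel[OF assms(1,5,9)]
    by blast
qed

end
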